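(* Let $m\ge n\ge 1$ be integers with $\gcd(m,n)\ne 1$. Then, with only one exception, the pair $(m,n)$ can be recovered from the combinatorial structure of $X(G_{m,n})$. That is: if $m_1\ge n_1\ge 1$ are integers such that $X(G_{m_1,n_1})$ and $X(G_{m,n})$ have the same combinatorial structure, then either $(m_1,n_1)=(m,n)$ or $\{(m,n),(m_1,n_1)\}=\{(3,3),(4,2)\}$; and $X(G_{3,3})$ and $X(G_{4,2})$ do have the same combinatorial structure.
   Context: $G_{m,n}=\langle x,y\mid x^m=y^n\rangle$, and its $SL(2,\mathbb{C})$-character variety is $X(G_{m,n})=\{(\operatorname{tr}\rho(x),\operatorname{tr}\rho(y),\operatorname{tr}\rho(xy))\mid\rho:G_{m,n}\to SL(2,\mathbb{C})\text{ a homomorphism}\}\subseteq\mathbb{C}^3$, an algebraic set all of whose irreducible components are curves; any two distinct components meet in finitely many points. The combinatorial structure of $X(G_{m,n})$ is the incidence data of its irreducible components: $X(G_{m,n})$ and $X(G_{m_1,n_1})$ have the same combinatorial structure if there is a bijection $\beta$ between their sets of irreducible components such that $\#(A\cap B)=\#(\beta(A)\cap\beta(B))$ for all distinct irreducible components $A,B$ of $X(G_{m,n})$. *)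

theory Defs
  imports "HOL-Analysis.Analysis" "HOL-Algebra.Group"
    "HOL-Computational_Algebra.Polynomial" "HOL-Library.Equipollence"
begin

section \<open>Group presentations\<close>

text \<open>The letter \<open>(a, True)\<close> stands for the generator \<open>a\<close> and \<open>(a, False)\<close> for its inverse.
  A pair \<open>(r, s)\<close> of words in \<open>R\<close> stands for the defining relation \<open>r = s\<close>.\<close>

type_synonym 'g word = "('g \<times> bool) list"

inductive pres_eq :: "('g word \<times> 'g word) set \<Rightarrow> 'g word \<Rightarrow> 'g word \<Rightarrow> bool"
  for R :: "('g word \<times> 'g word) set" where
  refl: "pres_eq R u u"
| sym: "pres_eq R u v \<Longrightarrow> pres_eq R v u"
| trans: "pres_eq R u v \<Longrightarrow> pres_eq R v w \<Longrightarrow> pres_eq R u w"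
| append: "pres_eq R u u' \<Longrightarrow> pres_eq R v v' \<Longrightarrow> pres_eq R (u @ v) (u' @ v')"
| cancel: "pres_eq R [(a, b), (a, \<not> b)] []"
| relation: "(r, s) \<in> R \<Longrightarrow> pres_eq R r s"

definition word_class :: "('g word \<times> 'g word) set \<Rightarrow> 'g word \<Rightarrow> 'g word set" where
  "word_class R u = {v. pres_eq R u v}"

definition presented_group :: "('g word \<times> 'g word) set \<Rightarrow> 'g word set monoid" where
  "presented_group R =
    \<lparr>carrier = range (word_class R),
     mult = (\<lambda>U V. \<Union>u\<in>U. \<Union>v\<in>V. word_class R (u @ v)),
     one = word_class R []\<rparr>"

lemma word_class_eq_iff: "word_class R u = word_class R v \<longleftrightarrow> pres_eq R u v"
  unfolding word_class_def by (blast intro: pres_eq.refl pres_eq.sym pres_eq.trans)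

lemma presented_group_mult:
  "word_class R u \<otimes>\<^bsub>presented_group R\<^esub> word_class R v = word_class R (u @ v)"
proof -
  have "word_class R (u' @ v') = word_class R (u @ v)"
    if "u' \<in> word_class R u" "v' \<in> word_class R v" for u' v'
    using that by (metis word_class_eq_iff word_class_def mem_Collect_eq pres_eq.append pres_eq.sym)
  moreover have "u \<in> word_class R u" "v \<in> word_class R v"
    by (simp_all add: word_class_def pres_eq.refl)
  ultimately have "(\<Union>u'\<in>word_class R u. \<Union>v'\<in>word_class R v. word_class R (u' @ v'))
      = word_class R (u @ v)"
    by blast
  then show ?thesis by (simp add: presented_group_def)
qed

lemma pres_eq_inverse:
  "pres_eq R (rev (map (\<lambda>(a, b). (a, \<not> b)) u) @ u) []"
proof (induction u)
  case Nil
  show ?case by (simp add: pres_eq.refl)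
next
  case (Cons l u)
  obtain a b where l: "l = (a, b)" by (cases l)
  let ?i = "rev (map (\<lambda>(a, b). (a, \<not> b)) u)"
  have "pres_eq R [(a, \<not> b), (a, b)] []"
    using pres_eq.cancel[of R a "\<not> b"] by simp
  then have "pres_eq R (?i @ ([(a, \<not> b), (a, b)] @ u)) (?i @ ([] @ u))"
    by (intro pres_eq.append pres_eq.refl)
  then show ?case
    using Cons.IH by (auto simp: l intro: pres_eq.trans)
qed

lemma group_presented_group: "group (presented_group R)"
proof (rule groupI)
  fix x assume "x \<in> carrier (presented_group R)"
  then obtain u where x: "x = word_class R u" by (auto simp: presented_group_def)
  let ?y = "word_class R (rev (map (\<lambda>(a, b). (a, \<not> b)) u))"
  have "?y \<otimes>\<^bsub>presented_group R\<^esub> x = \<one>\<^bsub>presented_group R\<^esub>"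
    unfolding x presented_group_mult
    by (simp add: presented_group_def word_class_eq_iff pres_eq_inverse)
  moreover have "?y \<in> carrier (presented_group R)" by (simp add: presented_group_def)
  ultimately show "\<exists>y\<in>carrier (presented_group R).
      y \<otimes>\<^bsub>presented_group R\<^esub> x = \<one>\<^bsub>presented_group R\<^esub>" by blast
next
  have carrier: "carrier (presented_group R) = range (word_class R)"
    and one: "\<one>\<^bsub>presented_group R\<^esub> = word_class R []"
    by (simp_all add: presented_group_def)
  show "\<one>\<^bsub>presented_group R\<^esub> \<in> carrier (presented_group R)"
    by (simp add: carrier one)
  fix x y z
  assume "x \<in> carrier (presented_group R)"
  then obtain u where x: "x = word_class R u" by (auto simp: carrier)
  show "\<one>\<^bsub>presented_group R\<^esub> \<otimes>\<^bsub>presented_group R\<^esub> x = x"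
    by (simp add: one x presented_group_mult)
  assume "y \<in> carrier (presented_group R)"
  then obtain v where y: "y = word_class R v" by (auto simp: carrier)
  show "x \<otimes>\<^bsub>presented_group R\<^esub> y \<in> carrier (presented_group R)"
    by (simp add: carrier x y presented_group_mult)
  assume "z \<in> carrier (presented_group R)"
  then obtain w where z: "z = word_class R w" by (auto simp: carrier)
  show "x \<otimes>\<^bsub>presented_group R\<^esub> y \<otimes>\<^bsub>presented_group R\<^esub> z
      = x \<otimes>\<^bsub>presented_group R\<^esub> (y \<otimes>\<^bsub>presented_group R\<^esub> z)"
    by (simp add: x y z presented_group_mult)
qed

section \<open>The groups \<open>G m n\<close> and their \<open>SL\<^sub>2\<close> character varieties\<close>

datatype gen = Gen_x | Gen_y

definition torus_relations :: "nat \<Rightarrow> nat \<Rightarrow> (gen word \<times> gen word) set" where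
  "torus_relations m n = {(replicate m (Gen_x, True), replicate n (Gen_y, True))}"

definition G :: "nat \<Rightarrow> nat \<Rightarrow> gen word set monoid" where
  "G m n = presented_group (torus_relations m n)"

definition G_gen :: "nat \<Rightarrow> nat \<Rightarrow> gen \<Rightarrow> gen word set" where
  "G_gen m n a = word_class (torus_relations m n) [(a, True)]"

definition SL2 :: "(complex ^ 2 ^ 2) monoid" where
  "SL2 = \<lparr>carrier = {A. det A = 1}, mult = (**), one = mat 1\<rparr>"

definition char_variety :: "nat \<Rightarrow> nat \<Rightarrow> (complex \<times> complex \<times> complex) set" where
  "char_variety m n =
    {(trace (\<rho> (G_gen m n Gen_x)),
      trace (\<rho> (G_gen m n Gen_y)),
      trace (\<rho> (G_gen m n Gen_x \<otimes>\<^bsub>G m n\<^esub> G_gen m n Gen_y))) | \<rho>. \<rho> \<in> hom (G m n) SL2}"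

section \<open>Algebraic subsets of affine 3-space and their irreducible components\<close>

text \<open>Polynomials in three variables are elements of \<open>\<complex>[x][y][z]\<close>.\<close>

definition eval3 :: "complex poly poly poly \<Rightarrow> complex \<times> complex \<times> complex \<Rightarrow> complex" where
  "eval3 f = (\<lambda>(a, b, c). poly (poly (poly f [:[:c:]:]) [:b:]) a)"

definition algebraic_set :: "(complex \<times> complex \<times> complex) set \<Rightarrow> bool" where
  "algebraic_set V \<longleftrightarrow> (\<exists>F. V = {p. \<forall>f\<in>F. eval3 f p = 0})"

definition irreducible_algebraic_set :: "(complex \<times> complex \<times> complex) set \<Rightarrow> bool" where
  "irreducible_algebraic_set V \<longleftrightarrow> algebraic_set V \<and> V \<noteq> {} \<and>
    (\<forall>V1 V2. algebraic_set V1 \<and> algebraic_set V2 \<and> V = V1 \<union> V2 \<longrightarrow> V = V1 \<or> V = V2)"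

definition irreducible_components ::
    "(complex \<times> complex \<times> complex) set \<Rightarrow> (complex \<times> complex \<times> complex) set set" where
  "irreducible_components X =
    {V. irreducible_algebraic_set V \<and> V \<subseteq> X \<and>
        (\<forall>W. irreducible_algebraic_set W \<and> V \<subseteq> W \<and> W \<subseteq> X \<longrightarrow> W = V)}"

text \<open>Intersections are compared by equipollence rather than by \<open>card\<close>,
  which would identify infinite intersections with empty ones.\<close>

definition same_combinatorial_structure ::
    "(complex \<times> complex \<times> complex) set \<Rightarrow> (complex \<times> complex \<times> complex) set \<Rightarrow> bool" where
  "same_combinatorial_structure X Y \<longleftrightarrow>
    (\<exists>\<beta>. bij_betw \<beta> (irreducible_components X) (irreducible_components Y) \<and>
      (\<forall>A\<in>irreducible_components X. \<forall>B\<in>irreducible_components X.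
        A \<noteq> B \<longrightarrow> A \<inter> B \<approx> \<beta> A \<inter> \<beta> B))"

end

theory Submission
  imports Defs "HOL-Library.Real_Mod"
begin

text \<open>A representation of the group is a pair of matrices \<open>A\<close>, \<open>B\<close> in \<open>SL2\<close> with \<open>A\<^sup>m = B\<^sup>n\<close>. If the pair
  is reducible, its character is that of a diagonal pair with eigenvalues \<open>\<xi>\<^sup>m = \<eta>\<^sup>n\<close>; if it is
  irreducible, then \<open>A\<^sup>m = B\<^sup>n\<close> is the identity or its negative, the traces of \<open>A\<close> and \<open>B\<close> belong to a finite
  set, and the trace of \<open>A B\<close> is arbitrary (\<open>char_variety_explicit\<close>). With \<open>d = gcd m n\<close>, \<open>m = d a\<close>,
  \<open>n = d b\<close>, the first family is a disjoint union of \<open>d div 2 + 1\<close> rational curves, one for each \<open>d\<close>-th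
  root of unity up to inversion, and the second is a disjoint union of vertical lines indexed by
  pairs \<open>0 < k < m\<close>, \<open>0 < l < n\<close> of equal parity. Each of these sets is closed and has a Laurent
  parametrisation, hence it is irreducible; none contains another, so they are the components.

  Each line contains exactly two reducible characters, so it meets the curves in two
  points. The combinatorial structure is therefore that of a graph with loops whose vertices are
  the curves and whose edges are the lines, with every edge subdivided. Which curves a line meets is
  read off from \<open>k - l\<close> and \<open>k + l\<close> modulo \<open>2 d\<close> (\<open>line_Int_curve\<close>).

  An isomorphism of these structures need not know which components are lines, but it
  preserves the sum of all degrees, which is four times the number of lines; hence also the number
  \<open>d div 2 + 1\<close> of curves; the number of lines that meet two different curves; and the set of
  degrees (\<open>combinatorial_invariants\<close>). Counting congruences gives these numbers:
  with \<open>x = d a b - a - b\<close>, the degree of a curve is \<open>x + 1\<close> if its root of unity is real and \<open>2 x\<close> otherwise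
  (\<open>degree_curve\<close>), and the number of lines meeting two different curves is a positive constant
  depending on \<open>d\<close> times \<open>a b\<close>, provided \<open>d \<ge> 2\<close> (\<open>card_simple_lines\<close>). So \<open>d\<close> is known up to the choice
  between an even number and its successor. If \<open>d\<close> is known, \<open>a b\<close> and \<open>a + b\<close> follow
  (\<open>equal_gcd_determine\<close>). If the choice is ambiguous, comparing degrees forces \<open>x = 1\<close> on both sides, and
  this leaves exactly the pairs \<open>(4, 2)\<close> and \<open>(3, 3)\<close> (\<open>even_odd_gcd_exception\<close>).\<close>

section \<open>Algebraic sets with a Laurent parametrisation\<close>

lemma eval3_arith:
  "eval3 (f + g) p = eval3 f p + eval3 g p"
  "eval3 (f * g) p = eval3 f p * eval3 g p"
  "eval3 [:[:[:c:]:]:] p = c"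
  "eval3 [:[:[:0, 1:]:]:] p = fst p"
  "eval3 [:[:0, 1:]:] p = fst (snd p)"
  "eval3 [:0, 1:] p = snd (snd p)"
  by (auto simp: eval3_def split: prod.splits)

definition polynomial_function :: "(complex \<times> complex \<times> complex \<Rightarrow> complex) \<Rightarrow> bool" where
  "polynomial_function g \<longleftrightarrow> (\<exists>f. \<forall>p. eval3 f p = g p)"

lemma polynomial_function_intros:
  "polynomial_function (\<lambda>p. c)"
  "polynomial_function fst"
  "polynomial_function (\<lambda>p. fst (snd p))"
  "polynomial_function (\<lambda>p. snd (snd p))"
  "polynomial_function g \<Longrightarrow> polynomial_function h \<Longrightarrow> polynomial_function (\<lambda>p. g p + h p)"
  "polynomial_function g \<Longrightarrow> polynomial_function h \<Longrightarrow> polynomial_function (\<lambda>p. g p * h p)"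
  unfolding polynomial_function_def by (metis eval3_arith)+

lemma polynomial_function_diff:
  assumes "polynomial_function g" "polynomial_function h"
  shows "polynomial_function (\<lambda>p. g p - h p)"
proof -
  have "polynomial_function (\<lambda>p. g p + (-1) * h p)"
    by (intro polynomial_function_intros assms)
  then show ?thesis by simp
qed

lemma algebraic_set_zeros:
  assumes "polynomial_function g"
  shows "algebraic_set {p. g p = 0}"
proof -
  obtain f where "\<And>p. eval3 f p = g p" using assms unfolding polynomial_function_def by blast
  then have "{p. g p = 0} = {p. \<forall>f\<in>{f}. eval3 f p = 0}" by auto
  then show ?thesis unfolding algebraic_set_def by blast
qed

lemma algebraic_set_Int:
  assumes "algebraic_set V" "algebraic_set W"
  shows "algebraic_set (V \<inter> W)"
proof -
  obtain F F' where "V = {p. \<forall>f\<in>F. eval3 f p = 0}" "W = {p. \<forall>f\<in>F'. eval3 f p = 0}"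
    using assms unfolding algebraic_set_def by blast
  then have "V \<inter> W = {p. \<forall>f\<in>F \<union> F'. eval3 f p = 0}" by blast
  then show ?thesis unfolding algebraic_set_def by blast
qed

lemma algebraic_set_Un:
  assumes "algebraic_set V" "algebraic_set W"
  shows "algebraic_set (V \<union> W)"
proof -
  obtain F F' where FF': "V = {p. \<forall>f\<in>F. eval3 f p = 0}" "W = {p. \<forall>f\<in>F'. eval3 f p = 0}"
    using assms unfolding algebraic_set_def by blast
  have "V \<union> W = {p. \<forall>h\<in>{f * g |f g. f \<in> F \<and> g \<in> F'}. eval3 h p = 0}"
    unfolding FF' by (fastforce simp: eval3_arith)
  then show ?thesis unfolding algebraic_set_def by blast
qed

lemma algebraic_set_Union:
  assumes "finite \<V>" "\<And>V. V \<in> \<V> \<Longrightarrow> algebraic_set V"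
  shows "algebraic_set (\<Union>\<V>)"
  using assms
proof (induction \<V> rule: finite_induct)
  case empty
  have "{} = {p. \<forall>f\<in>{[:[:[:1:]:]:]}. eval3 f p = 0}" by (simp add: eval3_arith)
  then have "algebraic_set {}" unfolding algebraic_set_def by blast
  then show ?case by simp
next
  case (insert V \<V>)
  then show ?case by (simp add: algebraic_set_Un)
qed

lemma irreducible_imp_algebraic: "irreducible_algebraic_set V \<Longrightarrow> algebraic_set V"
  unfolding irreducible_algebraic_set_def by (elim conjE)

lemma irreducible_subset_Un:
  assumes "irreducible_algebraic_set W" "algebraic_set A" "algebraic_set B" "W \<subseteq> A \<union> B"
  shows "W \<subseteq> A \<or> W \<subseteq> B"
proof -
  have alg: "algebraic_set (W \<inter> A)" "algebraic_set (W \<inter> B)"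
    using irreducible_imp_algebraic[OF assms(1)] assms(2,3) by (auto intro: algebraic_set_Int)
  have "W = (W \<inter> A) \<union> (W \<inter> B)" using assms(4) by blast
  moreover have "\<forall>V1 V2. algebraic_set V1 \<and> algebraic_set V2 \<and> W = V1 \<union> V2 \<longrightarrow> W = V1 \<or> W = V2"
    using assms(1) unfolding irreducible_algebraic_set_def by (elim conjE)
  ultimately have "W = W \<inter> A \<or> W = W \<inter> B" using alg by metis
  then show ?thesis by blast
qed

lemma irreducible_subset_Union:
  assumes "irreducible_algebraic_set W" "finite \<V>" "\<And>V. V \<in> \<V> \<Longrightarrow> algebraic_set V" "W \<subseteq> \<Union>\<V>"
  shows "\<exists>V\<in>\<V>. W \<subseteq> V"
  using assms(2-)
proof (induction \<V> rule: finite_induct)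
  case empty
  then have "W = {}" by simp
  then show ?case using assms(1) unfolding irreducible_algebraic_set_def by blast
next
  case (insert V \<V>)
  have "W \<subseteq> V \<or> W \<subseteq> \<Union>\<V>"
    using insert by (intro irreducible_subset_Un[OF assms(1)] algebraic_set_Union) auto
  then show ?case using insert by auto
qed

text \<open>An irreducible subset of a finite union of closed sets lies in one of them; so a finite list of
  pairwise incomparable irreducible sets is automatically the list of components of its union.\<close>

lemma irreducible_components_Union:
  assumes "finite \<V>" and irr: "\<And>V. V \<in> \<V> \<Longrightarrow> irreducible_algebraic_set V"
    and incomp: "\<And>V W. V \<in> \<V> \<Longrightarrow> W \<in> \<V> \<Longrightarrow> V \<subseteq> W \<Longrightarrow> V = W"
  shows "irreducible_components (\<Union>\<V>) = \<V>"
proof -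
  have below: "\<exists>V\<in>\<V>. W \<subseteq> V" if "irreducible_algebraic_set W" "W \<subseteq> \<Union>\<V>" for W
    using irreducible_subset_Union[OF that(1) assms(1) _ that(2)] irr irreducible_imp_algebraic
    by blast
  show ?thesis
  proof (intro equalityI subsetI)
    fix V assume V: "V \<in> irreducible_components (\<Union>\<V>)"
    then obtain W where W: "W \<in> \<V>" "V \<subseteq> W"
      using below[of V] unfolding irreducible_components_def by blast
    then have "W = V" using V irr[OF W(1)] unfolding irreducible_components_def by blast
    then show "V \<in> \<V>" using W by simp
  next
    fix V assume V: "V \<in> \<V>"
    have "W = V" if W: "irreducible_algebraic_set W" "V \<subseteq> W" "W \<subseteq> \<Union>\<V>" for W
    proof -
      obtain V' where "V' \<in> \<V>" "W \<subseteq> V'" using below W by blast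
      then show ?thesis using incomp[OF V, of V'] W by blast
    qed
    then show "V \<in> irreducible_components (\<Union>\<V>)"
      using V irr unfolding irreducible_components_def by blast
  qed
qed

definition laurent_function :: "(complex \<Rightarrow> complex) \<Rightarrow> bool" where
  "laurent_function g \<longleftrightarrow> (\<exists>N q. \<forall>t. t \<noteq> 0 \<longrightarrow> t ^ N * g t = poly q t)"

lemma laurent_function_const: "laurent_function (\<lambda>t. c)"
  unfolding laurent_function_def by (rule exI[of _ 0], rule exI[of _ "[:c:]"]) simp

lemma laurent_function_power: "laurent_function (\<lambda>t. t ^ k)"
  unfolding laurent_function_def by (rule exI[of _ 0], rule exI[of _ "monom 1 k"]) (simp add: poly_monom)

lemma laurent_function_inverse_power: "laurent_function (\<lambda>t. inverse (t ^ k))"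
  unfolding laurent_function_def by (rule exI[of _ k], rule exI[of _ "[:1:]"]) simp

lemma laurent_function_add:
  assumes "laurent_function g" "laurent_function h"
  shows "laurent_function (\<lambda>t. g t + h t)"
proof -
  obtain N q M r where qr: "\<And>t. t \<noteq> 0 \<Longrightarrow> t ^ N * g t = poly q t"
      "\<And>t. t \<noteq> 0 \<Longrightarrow> t ^ M * h t = poly r t"
    using assms unfolding laurent_function_def by blast
  have "t ^ (N + M) * (g t + h t) = poly (monom 1 M * q + monom 1 N * r) t" if "t \<noteq> 0" for t
    using qr[OF that, symmetric] by (simp add: poly_monom algebra_simps power_add)
  then show ?thesis unfolding laurent_function_def by blast
qed

lemma laurent_function_mult:
  assumes "laurent_function g" "laurent_function h"
  shows "laurent_function (\<lambda>t. g t * h t)"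
proof -
  obtain N q M r where qr: "\<And>t. t \<noteq> 0 \<Longrightarrow> t ^ N * g t = poly q t"
      "\<And>t. t \<noteq> 0 \<Longrightarrow> t ^ M * h t = poly r t"
    using assms unfolding laurent_function_def by blast
  have "t ^ (N + M) * (g t * h t) = poly (q * r) t" if "t \<noteq> 0" for t
    using qr[OF that, symmetric] by (simp add: algebra_simps power_add)
  then show ?thesis unfolding laurent_function_def by blast
qed

lemma laurent_function_eval3:
  assumes X: "laurent_function X" and Y: "laurent_function Y" and Z: "laurent_function Z"
  shows "laurent_function (\<lambda>t. eval3 f (X t, Y t, Z t))"
proof -
  have 1: "laurent_function (\<lambda>t. poly h (X t))" for h
    by (induction h) (auto intro!: laurent_function_add laurent_function_mult X laurent_function_const)
  have 2: "laurent_function (\<lambda>t. poly (poly h [:Y t:]) (X t))" for h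
    by (induction h)
       (auto intro!: laurent_function_add laurent_function_mult 1 Y laurent_function_const)
  have "laurent_function (\<lambda>t. poly (poly (poly h [:[:Z t:]:]) [:Y t:]) (X t))" for h
    by (induction h)
       (auto intro!: laurent_function_add laurent_function_mult 2 Z laurent_function_const)
  then show ?thesis by (simp add: eval3_def)
qed

text \<open>Clearing the denominator turns the zeros in the punctured plane into roots of a polynomial, and
  a nonzero polynomial has only finitely many.\<close>

lemma laurent_function_zeros:
  assumes "laurent_function g" "infinite {t. t \<noteq> 0 \<and> g t = 0}" "t \<noteq> 0"
  shows "g t = 0"
proof -
  obtain N q where q: "\<And>t. t \<noteq> 0 \<Longrightarrow> t ^ N * g t = poly q t"
    using assms(1) unfolding laurent_function_def by blast
  have "{t. t \<noteq> 0 \<and> g t = 0} \<subseteq> {t. poly q t = 0}"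
  proof
    fix t assume "t \<in> {t. t \<noteq> 0 \<and> g t = 0}"
    then show "t \<in> {t. poly q t = 0}" using q[of t] by simp
  qed
  then have "q = 0" using assms(2) poly_roots_finite finite_subset by blast
  then show ?thesis using q[OF assms(3)] assms(3) by simp
qed

text \<open>If two closed sets cover the image, one of them contains the image of infinitely many
  parameters. A polynomial vanishing on that set pulls back to a Laurent polynomial with
  infinitely many zeros, so it vanishes on the whole image.\<close>

lemma irreducible_laurent_image:
  assumes alg: "algebraic_set V" and V: "V = (\<lambda>t. (X t, Y t, Z t)) ` (- {0})"
    and XYZ: "laurent_function X" "laurent_function Y" "laurent_function Z"
  shows "irreducible_algebraic_set V"
proof -
  \<comment> \<open>A closed set containing infinitely many parameter values contains all of the image.\<close>
  have full: "V \<subseteq> W" if W: "algebraic_set W" and inf: "infinite {t. t \<noteq> 0 \<and> (X t, Y t, Z t) \<in> W}" for W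
  proof -
    obtain F where F: "W = {p. \<forall>f\<in>F. eval3 f p = 0}"
      using W unfolding algebraic_set_def by blast
    have "eval3 f (X t, Y t, Z t) = 0" if f: "f \<in> F" and t: "t \<noteq> 0" for f t
    proof (rule laurent_function_zeros[OF laurent_function_eval3[OF XYZ] _ t])
      have "{t. t \<noteq> 0 \<and> (X t, Y t, Z t) \<in> W} \<subseteq> {t. t \<noteq> 0 \<and> eval3 f (X t, Y t, Z t) = 0}"
        using f by (auto simp: F)
      then show "infinite {t. t \<noteq> 0 \<and> eval3 f (X t, Y t, Z t) = 0}"
        using inf finite_subset by blast
    qed
    then show ?thesis unfolding V F by auto
  qed
  have irr: "V = V1 \<or> V = V2" if V12: "algebraic_set V1" "algebraic_set V2" "V = V1 \<union> V2" for V1 V2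
  proof -
    have split: "- {0} = {t. t \<noteq> 0 \<and> (X t, Y t, Z t) \<in> V1} \<union> {t. t \<noteq> 0 \<and> (X t, Y t, Z t) \<in> V2}"
      using V12(3) unfolding V by blast
    have "infinite (- {0 :: complex})"
      by (simp add: Compl_eq_Diff_UNIV infinite_UNIV_char_0)
    then have "infinite {t. t \<noteq> 0 \<and> (X t, Y t, Z t) \<in> V1} \<or>
        infinite {t. t \<noteq> 0 \<and> (X t, Y t, Z t) \<in> V2}"
      unfolding split by (simp only: finite_Un de_Morgan_conj)
    then have "V \<subseteq> V1 \<or> V \<subseteq> V2" using full[OF V12(1)] full[OF V12(2)] by (elim disjE) simp_all
    moreover have "V1 \<subseteq> V" "V2 \<subseteq> V" using V12(3) by simp_all
    ultimately show ?thesis by (simp only: set_eq_subset simp_thms)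
  qed
  have "(X 1, Y 1, Z 1) \<in> V" unfolding V by simp
  then have "V \<noteq> {}" by blast
  then show ?thesis using alg irr unfolding irreducible_algebraic_set_def
    by (intro conjI allI impI) (simp_all only: not_False_eq_True)
qed

section \<open>Homomorphisms from \<open>G m n\<close> to \<open>SL2\<close>\<close>

type_synonym mat2 = "complex ^ 2 ^ 2"

primrec mat_pow :: "mat2 \<Rightarrow> nat \<Rightarrow> mat2" where
  "mat_pow A 0 = mat 1"
| "mat_pow A (Suc k) = A ** mat_pow A k"

definition adjugate2 :: "mat2 \<Rightarrow> mat2" where
  "adjugate2 A = vector [vector [A$2$2, - A$1$2], vector [- A$2$1, A$1$1]]"

lemma adjugate2_entry [simp]:
  "adjugate2 A $ 1 $ 1 = A$2$2" "adjugate2 A $ 1 $ 2 = - A$1$2"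
  "adjugate2 A $ 2 $ 1 = - A$2$1" "adjugate2 A $ 2 $ 2 = A$1$1"
  by (simp_all add: adjugate2_def)

lemma trace2: "trace (A :: mat2) = A$1$1 + A$2$2"
  by (simp add: trace_def sum_2)

lemma mat2_mult_entry: "((A :: mat2) ** B) $ i $ j = A$i$1 * B$1$j + A$i$2 * B$2$j"
  by (simp add: matrix_matrix_mult_def sum_2)

lemma mat2_mult_vec_entry: "((A :: mat2) *v v) $ i = A$i$1 * v$1 + A$i$2 * v$2"
  by (simp add: matrix_vector_mult_def sum_2)

lemma mat_entry: "(mat k :: mat2) $ i $ j = (if i = j then k else 0)"
  by (simp add: mat_def)

lemma mult_adjugate2:
  fixes A :: mat2
  assumes "det A = 1"
  shows "A ** adjugate2 A = mat 1" "adjugate2 A ** A = mat 1"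
  using assms by (auto simp: vec_eq_iff forall_2 mat2_mult_entry det_2 mat_entry algebra_simps)

lemma det_adjugate2: "det (adjugate2 A) = det A"
  by (simp add: det_2 algebra_simps)

definition eval_word :: "(gen \<Rightarrow> mat2) \<Rightarrow> gen word \<Rightarrow> mat2" where
  "eval_word M w = foldr (\<lambda>(g, b) C. (if b then M g else adjugate2 (M g)) ** C) w (mat 1)"

lemma eval_word_Nil [simp]: "eval_word M [] = mat 1"
  and eval_word_Cons: "eval_word M ((g, b) # w) = (if b then M g else adjugate2 (M g)) ** eval_word M w"
  by (simp_all add: eval_word_def)

lemma eval_word_append: "eval_word M (u @ v) = eval_word M u ** eval_word M v"
  by (induction u) (auto simp: eval_word_Cons matrix_mul_assoc)

lemma eval_word_replicate: "eval_word M (replicate k (g, True)) = mat_pow (M g) k"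
  by (induction k) (simp_all add: eval_word_Cons)

lemma det_eval_word:
  assumes "\<And>g. det (M g) = 1"
  shows "det (eval_word M w) = 1"
  by (induction w) (auto simp: eval_word_Cons det_mul det_adjugate2 assms)

text \<open>The universal property of the presentation: a choice of matrices that satisfies the relations
  is constant on the classes of words.\<close>

lemma eval_word_pres_eq:
  assumes det: "\<And>g. det (M g) = 1" and R: "\<And>r s. (r, s) \<in> R \<Longrightarrow> eval_word M r = eval_word M s"
    and "pres_eq R u v"
  shows "eval_word M u = eval_word M v"
  using assms(3)
proof induction
  case (cancel a b)
  then show ?case using mult_adjugate2[OF det[of a]] by (simp add: eval_word_Cons)
qed (auto simp: eval_word_append R)

definition torus_pairs :: "nat \<Rightarrow> nat \<Rightarrow> (mat2 \<times> mat2) set" where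
  "torus_pairs m n = {(A, B). det A = 1 \<and> det B = 1 \<and> mat_pow A m = mat_pow B n}"

text \<open>A homomorphism is the same thing as a pair of matrices with equal powers, which removes words
  and presentations from the rest of the argument.\<close>

lemma char_variety_eq_torus_pairs:
  assumes "m \<ge> 1" "n \<ge> 1"
  shows "char_variety m n = (\<lambda>(A, B). (trace A, trace B, trace (A ** B))) ` torus_pairs m n"
proof (intro equalityI subsetI)
  fix p assume "p \<in> char_variety m n"
  then obtain \<rho> where \<rho>: "\<rho> \<in> hom (G m n) SL2"
    and p: "p = (trace (\<rho> (G_gen m n Gen_x)), trace (\<rho> (G_gen m n Gen_y)),
      trace (\<rho> (G_gen m n Gen_x \<otimes>\<^bsub>G m n\<^esub> G_gen m n Gen_y)))"
    unfolding char_variety_def by blast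
  let ?c = "word_class (torus_relations m n)"
  have carrier: "?c w \<in> carrier (G m n)" for w by (simp add: G_def presented_group_def)
  have mult: "\<rho> (?c (u @ v)) = \<rho> (?c u) ** \<rho> (?c v)" for u v
    using hom_mult[OF \<rho> carrier carrier, of u v]
    by (simp add: G_def presented_group_mult SL2_def)
  have pow: "\<rho> (?c (replicate (Suc k) (g, True))) = mat_pow (\<rho> (G_gen m n g)) (Suc k)" for k g
  proof (induction k)
    case 0
    then show ?case by (simp add: G_gen_def)
  next
    case (Suc k)
    then show ?case using mult[of "[(g, True)]" "replicate (Suc k) (g, True)"]
      by (simp add: G_gen_def)
  qed
  have "pres_eq (torus_relations m n) (replicate m (Gen_x, True)) (replicate n (Gen_y, True))"
    by (rule pres_eq.relation) (simp add: torus_relations_def)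
  then have "?c (replicate m (Gen_x, True)) = ?c (replicate n (Gen_y, True))"
    by (simp add: word_class_eq_iff)
  then have "mat_pow (\<rho> (G_gen m n Gen_x)) m = mat_pow (\<rho> (G_gen m n Gen_y)) n"
    using pow[of "m - 1" Gen_x] pow[of "n - 1" Gen_y] assms by simp
  moreover have "det (\<rho> (G_gen m n g)) = 1" for g
    using hom_in_carrier[OF \<rho>, of "G_gen m n g"] carrier by (simp add: G_gen_def SL2_def)
  moreover have "\<rho> (G_gen m n Gen_x \<otimes>\<^bsub>G m n\<^esub> G_gen m n Gen_y)
      = \<rho> (G_gen m n Gen_x) ** \<rho> (G_gen m n Gen_y)"
    using hom_mult[OF \<rho> carrier carrier] by (simp add: G_gen_def SL2_def)
  ultimately show "p \<in> (\<lambda>(A, B). (trace A, trace B, trace (A ** B))) ` torus_pairs m n"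
    unfolding p torus_pairs_def
    by (intro image_eqI[of _ _ "(\<rho> (G_gen m n Gen_x), \<rho> (G_gen m n Gen_y))"]) auto
next
  fix p assume "p \<in> (\<lambda>(A, B). (trace A, trace B, trace (A ** B))) ` torus_pairs m n"
  then obtain A B where AB: "det A = 1" "det B = 1" "mat_pow A m = mat_pow B n"
    and p: "p = (trace A, trace B, trace (A ** B))"
    unfolding torus_pairs_def by auto
  define M where "M g = (case g of Gen_x \<Rightarrow> A | Gen_y \<Rightarrow> B)" for g
  have det: "det (M g) = 1" for g using AB by (cases g) (simp_all add: M_def)
  have M: "M Gen_x = A" "M Gen_y = B" by (simp_all add: M_def)
  let ?c = "word_class (torus_relations m n)"
  define \<rho> where "\<rho> U = eval_word M (SOME u. U = ?c u)" for U
  have \<rho>: "\<rho> (?c u) = eval_word M u" for u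
  proof -
    have "?c u = ?c (SOME v. ?c u = ?c v)" by (rule someI[of _ u]) (rule HOL.refl)
    then have "pres_eq (torus_relations m n) u (SOME v. ?c u = ?c v)"
      by (simp only: word_class_eq_iff)
    then have "eval_word M u = eval_word M (SOME v. ?c u = ?c v)"
    proof (rule eval_word_pres_eq[OF det, rotated])
      show "eval_word M r = eval_word M s" if "(r, s) \<in> torus_relations m n" for r s
        using that AB(3) by (simp add: torus_relations_def eval_word_replicate M)
    qed
    then show ?thesis by (simp add: \<rho>_def)
  qed
  have carrier: "carrier (G m n) = range ?c" by (simp add: G_def presented_group_def)
  have "\<rho> \<in> hom (G m n) SL2"
  proof (rule homI)
    fix U assume "U \<in> carrier (G m n)"
    then obtain u where U: "U = ?c u" unfolding carrier by blast
    show "\<rho> U \<in> carrier SL2" unfolding U \<rho> by (simp add: SL2_def det_eval_word[OF det])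
    fix V assume "V \<in> carrier (G m n)"
    then obtain v where V: "V = ?c v" unfolding carrier by blast
    show "\<rho> (U \<otimes>\<^bsub>G m n\<^esub> V) = \<rho> U \<otimes>\<^bsub>SL2\<^esub> \<rho> V"
      unfolding U V G_def presented_group_mult \<rho> by (simp add: SL2_def eval_word_append)
  qed
  moreover have "\<rho> (G_gen m n Gen_x) = A" "\<rho> (G_gen m n Gen_y) = B"
      "\<rho> (G_gen m n Gen_x \<otimes>\<^bsub>G m n\<^esub> G_gen m n Gen_y) = A ** B"
    by (simp_all add: G_gen_def G_def presented_group_mult \<rho> eval_word_Cons M)
  ultimately show "p \<in> char_variety m n"
    unfolding char_variety_def p by (intro CollectI exI[of _ \<rho>]) simp
qed

section \<open>Traces of pairs in \<open>SL2\<close> with equal powers\<close>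

text \<open>The trace of a matrix in \<open>SL2\<close> with eigenvalue \<open>z\<close>.\<close>

definition joukowski :: "complex \<Rightarrow> complex" where
  "joukowski z = z + inverse z"

text \<open>The character of a reducible pair: \<open>\<xi>\<close> and \<open>\<eta>\<close> are the eigenvalues on a common eigenvector.\<close>

definition diag_char :: "complex \<Rightarrow> complex \<Rightarrow> complex \<times> complex \<times> complex" where
  "diag_char \<xi> \<eta> = (joukowski \<xi>, joukowski \<eta>, joukowski (\<xi> * \<eta>))"

text \<open>The Chebyshev polynomials of the second kind, normalised so that at \<open>joukowski z\<close> the value with
  index \<open>k\<close> is \<open>(z ^ k - inverse z ^ k) / (z - inverse z)\<close>.\<close>

fun cheb :: "complex \<Rightarrow> nat \<Rightarrow> complex" where
  "cheb s 0 = 0"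
| "cheb s (Suc 0) = 1"
| "cheb s (Suc (Suc k)) = s * cheb s (Suc k) - cheb s k"

lemma joukowski_surj: "\<exists>z. z \<noteq> 0 \<and> joukowski z = s"
proof -
  define r where "r = csqrt (s\<^sup>2 - 4)"
  have r: "r\<^sup>2 = s\<^sup>2 - 4" by (simp add: r_def)
  have "(s + r) / 2 * ((s - r) / 2) = 1"
    using r by (simp add: power2_eq_square algebra_simps)
  then have "(s + r) / 2 \<noteq> 0 \<and> inverse ((s + r) / 2) = (s - r) / 2"
    by (metis inverse_unique mult_zero_left zero_neq_one)
  moreover have "(s + r) / 2 + (s - r) / 2 = s" by (simp add: field_simps)
  ultimately show ?thesis unfolding joukowski_def by metis
qed

lemma joukowski_eq_iff:
  assumes "w \<noteq> 0" "z \<noteq> 0"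
  shows "joukowski w = joukowski z \<longleftrightarrow> w = z \<or> w = inverse z"
proof -
  have "joukowski w - joukowski z = (w - z) * (w - inverse z) * inverse w"
    using assms by (simp add: joukowski_def field_simps)
  then show ?thesis using assms by auto
qed

lemma joukowski_inverse [simp]: "joukowski (inverse z) = joukowski z"
  by (simp add: joukowski_def)

lemma cheb_joukowski_power:
  assumes "z \<noteq> 0"
  shows "z ^ Suc k = cheb (joukowski z) (Suc k) * z - cheb (joukowski z) k"
proof (induction k)
  case (Suc k)
  let ?u = "cheb (joukowski z)"
  have "z ^ Suc (Suc k) = ?u (Suc k) * z\<^sup>2 - ?u k * z"
    unfolding power_Suc[of z "Suc k"] Suc by (simp add: power2_eq_square algebra_simps)
  also have "z\<^sup>2 = joukowski z * z - 1"
    using assms by (simp add: joukowski_def power2_eq_square algebra_simps)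
  finally show ?case by (simp add: algebra_simps)
qed simp

text \<open>At the traces \<open>2\<close> and \<open>- 2\<close> no Chebyshev polynomial with positive index vanishes: a nonscalar
  matrix with eigenvalue \<open>1\<close> or \<open>- 1\<close> has no scalar power with positive exponent. This is why the eigenvalues on a vertical line differ
  from \<open>1\<close> and \<open>- 1\<close>.\<close>

lemma cheb_two:
  assumes "z\<^sup>2 = 1"
  shows "cheb (joukowski z) (Suc k) = of_nat (Suc k) * z ^ k"
proof -
  have zz: "z * z = 1" using assms by (simp add: power2_eq_square)
  have "inverse z = z" using zz by (metis inverse_unique)
  then have J: "joukowski z = 2 * z" by (simp add: joukowski_def)
  have "cheb (joukowski z) k = of_nat k * z ^ Suc k \<and>
      cheb (joukowski z) (Suc k) = of_nat (Suc k) * z ^ k"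
  proof (induction k)
    case (Suc k)
    have "z ^ Suc (Suc k) = z ^ k" using zz by (simp add: mult.assoc[symmetric])
    have "cheb (joukowski z) (Suc (Suc k)) = 2 * z * (of_nat (Suc k) * z ^ k) - of_nat k * z ^ Suc k"
      using Suc by (simp add: J)
    moreover have "\<dots> = of_nat (Suc (Suc k)) * z ^ Suc k" by (simp add: algebra_simps)
    ultimately have "cheb (joukowski z) (Suc (Suc k)) = of_nat (Suc (Suc k)) * z ^ Suc k" by simp
    then show ?case using Suc \<open>z ^ Suc (Suc k) = z ^ k\<close> by metis
  qed simp
  then show ?thesis by blast
qed

text \<open>By the Cayley--Hamilton theorem every power of \<open>A\<close> is an affine function of \<open>A\<close>, with coefficients
  depending on the trace alone. Comparing entries turns this into an identity of complex numbers.\<close>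

lemma mat_pow_entry:
  fixes A :: mat2
  assumes "det A = 1"
  shows "mat_pow A (Suc k) $ i $ j
    = cheb (trace A) (Suc k) * A $ i $ j - cheb (trace A) k * (mat 1 :: mat2) $ i $ j"
proof (induction k arbitrary: i j)
  case 0
  then show ?case by simp
next
  case (Suc k)
  let ?u = "cheb (trace A)"
  have d: "A$1$1 * A$2$2 = 1 + A$1$2 * A$2$1" using assms by (simp add: det_2 algebra_simps)
  have CH: "(A ** A) $ i $ j = trace A * A $ i $ j - (mat 1 :: mat2) $ i $ j" for i j
  proof -
    have "\<forall>i j. (A ** A) $ i $ j = trace A * A $ i $ j - (mat 1 :: mat2) $ i $ j"
      unfolding forall_2 using d
      by (simp add: mat2_mult_entry mat_entry trace2 algebra_simps)
    then show ?thesis by blast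
  qed
  have "mat_pow A (Suc (Suc k)) $ i $ j
      = ?u (Suc k) * (A ** A) $ i $ j - ?u k * (A ** mat 1) $ i $ j"
    unfolding mat_pow.simps(2)[of A "Suc k"] mat2_mult_entry Suc by (simp add: algebra_simps)
  also have "\<dots> = ?u (Suc (Suc k)) * A $ i $ j - ?u (Suc k) * (mat 1 :: mat2) $ i $ j"
    by (simp only: CH matrix_mul_rid) (simp add: algebra_simps)
  finally show ?case .
qed

lemma SL2_eigenvalue:
  fixes A :: mat2
  assumes "det A = 1" "A *v v = \<xi> *s v" "v \<noteq> 0"
  shows "\<xi> \<noteq> 0" "trace A = joukowski \<xi>"
proof -
  have e: "A$1$1 * v$1 + A$1$2 * v$2 = \<xi> * v$1" "A$2$1 * v$1 + A$2$2 * v$2 = \<xi> * v$2"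
    using assms(2) by (simp_all add: vec_eq_iff forall_2 mat2_mult_vec_entry)
  have d: "A$1$1 * A$2$2 - A$1$2 * A$2$1 = 1" using assms(1) by (simp add: det_2)
  have "(\<xi>\<^sup>2 - trace A * \<xi> + 1) * v$1 = 0 \<and> (\<xi>\<^sup>2 - trace A * \<xi> + 1) * v$2 = 0"
    using e d unfolding trace2 power2_eq_square by algebra
  then have "\<xi>\<^sup>2 - trace A * \<xi> + 1 = 0"
    using assms(3) by (auto simp: vec_eq_iff forall_2)
  then have "trace A * \<xi> = \<xi> * \<xi> + 1" by (simp add: power2_eq_square algebra_simps)
  moreover from this show "\<xi> \<noteq> 0" by auto
  ultimately have "trace A = (\<xi> * \<xi> + 1) * inverse \<xi>" by (metis mult.assoc mult.right_neutral right_inverse)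
  then show "trace A = joukowski \<xi>"
    using \<open>\<xi> \<noteq> 0\<close> by (simp add: joukowski_def algebra_simps)
qed

text \<open>By the characteristic equation both \<open>v\<close> and \<open>w\<close> are annihilated by \<open>A - \<xi>\<close>; they vanish together
  only if \<open>A\<close> is the scalar matrix \<open>\<xi>\<close>.\<close>

lemma SL2_eigenvector:
  fixes A :: mat2
  assumes "det A = 1" "trace A = joukowski \<xi>" "\<xi> \<noteq> 0"
  shows "\<exists>v. v \<noteq> 0 \<and> A *v v = \<xi> *s v"
proof -
  have d: "A$1$1 * A$2$2 - A$1$2 * A$2$1 = 1" using assms(1) by (simp add: det_2)
  have t: "\<xi> * (A$1$1 + A$2$2) = \<xi> * \<xi> + 1" using assms(2,3) unfolding trace2
    by (simp add: joukowski_def field_simps)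
  have key: "(\<xi> - A$1$1) * (\<xi> - A$2$2) = A$1$2 * A$2$1" using d t by algebra
  define v w :: "complex ^ 2" where "v = vector [A$1$2, \<xi> - A$1$1]" and "w = vector [\<xi> - A$2$2, A$2$1]"
  have "A *v v = \<xi> *s v" "A *v w = \<xi> *s w"
    using key by (simp_all add: vec_eq_iff forall_2 mat2_mult_vec_entry v_def w_def algebra_simps)
  moreover have "A *v axis 1 1 = \<xi> *s axis 1 1" if "v = 0" "w = 0"
    using that by (auto simp: vec_eq_iff forall_2 mat2_mult_vec_entry v_def w_def axis_def)
  moreover have "axis 1 1 \<noteq> (0 :: complex ^ 2)" by (simp add: axis_eq_0_iff)
  ultimately show ?thesis by blast
qed

lemma mat_pow_eigenvector:
  assumes "A *v v = \<xi> *s v"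
  shows "mat_pow A k *v v = \<xi> ^ k *s v"
  by (induction k) (simp_all add: matrix_vector_mul_assoc[symmetric] vector_scalar_commute assms mult.commute)

lemma common_eigenvector_char:
  fixes A B :: mat2
  assumes "det A = 1" "det B = 1" "mat_pow A m = mat_pow B n"
    and "v \<noteq> 0" "A *v v = \<xi> *s v" "B *v v = \<eta> *s v"
  shows "(trace A, trace B, trace (A ** B)) = diag_char \<xi> \<eta> \<and> \<xi> \<noteq> 0 \<and> \<eta> \<noteq> 0 \<and> \<xi> ^ m = \<eta> ^ n"
proof -
  have "\<xi> ^ m *s v = \<eta> ^ n *s v"
    using mat_pow_eigenvector[OF assms(5), of m] mat_pow_eigenvector[OF assms(6), of n] assms(3)
    by metis
  then have "\<xi> ^ m = \<eta> ^ n" using assms(4) by simp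
  moreover have "(A ** B) *v v = (\<xi> * \<eta>) *s v"
    by (simp add: matrix_vector_mul_assoc[symmetric] vector_scalar_commute assms(5,6) mult.commute)
  ultimately show ?thesis
    using SL2_eigenvalue[OF assms(1,5,4)] SL2_eigenvalue[OF assms(2,6,4)]
      SL2_eigenvalue[of "A ** B" v "\<xi> * \<eta>"] assms(1,2,4)
    by (simp add: diag_char_def det_mul)
qed

text \<open>An affine function of \<open>B\<close> has the eigenvectors of \<open>B\<close>.\<close>

lemma affine_common_eigenvector:
  fixes A B :: mat2
  assumes "det B = 1" and A: "\<And>i j. A $ i $ j = \<alpha> * B $ i $ j + \<beta> * (mat 1 :: mat2) $ i $ j"
  shows "\<exists>v \<xi> \<eta>. v \<noteq> 0 \<and> A *v v = \<xi> *s v \<and> B *v v = \<eta> *s v"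
proof -
  obtain \<eta> where "\<eta> \<noteq> 0" "trace B = joukowski \<eta>" using joukowski_surj[of "trace B"] by metis
  then obtain v where v: "v \<noteq> 0" "B *v v = \<eta> *s v" using SL2_eigenvector[OF assms(1)] by blast
  have "B$1$1 * v$1 + B$1$2 * v$2 = \<eta> * v$1" "B$2$1 * v$1 + B$2$2 * v$2 = \<eta> * v$2"
    using v(2) by (simp_all add: vec_eq_iff forall_2 mat2_mult_vec_entry)
  then have "A *v v = (\<alpha> * \<eta> + \<beta>) *s v"
    unfolding vec_eq_iff forall_2 mat2_mult_vec_entry A
    by (simp add: mat_entry algebra_simps) algebra
  with v show ?thesis by blast
qed

text \<open>The eigenvalues \<open>\<xi>\<close> and \<open>inverse \<xi>\<close> are distinct and have the same \<open>m\<close>-th power, so the affine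
  function of \<open>A\<close> that equals this power has no linear term.\<close>

lemma SL2_power_scalar:
  fixes A :: mat2
  assumes "det A = 1" "trace A = joukowski \<xi>" "\<xi>\<^sup>2 \<noteq> 1" "\<xi> ^ (2 * m) = 1" "m \<ge> 1"
  shows "mat_pow A m = mat (\<xi> ^ m)"
proof -
  obtain k where m: "m = Suc k" using assms(5) by (cases m) auto
  let ?u = "cheb (joukowski \<xi>)"
  have nz: "\<xi> \<noteq> 0" using assms(4,5) by (auto simp: power_0_left)
  have "\<xi> ^ m * \<xi> ^ m = 1" using assms(4) by (simp add: power_add[symmetric] mult_2)
  then have "inverse \<xi> ^ m = \<xi> ^ m" using inverse_unique by (metis power_inverse)
  then have "?u m * inverse \<xi> - ?u k = ?u m * \<xi> - ?u k"
    using cheb_joukowski_power[of \<xi> k] cheb_joukowski_power[of "inverse \<xi>" k] nz m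
    by (metis inverse_nonzero_iff_nonzero joukowski_inverse)
  then have "?u m * (inverse \<xi> - \<xi>) = 0" by (simp add: algebra_simps)
  moreover have "inverse \<xi> \<noteq> \<xi>" using assms(3) nz by (metis power2_eq_square right_inverse)
  ultimately have u0: "?u m = 0" by simp
  then have "?u k = - (\<xi> ^ m)" using cheb_joukowski_power[of \<xi> k] nz m by simp
  then have "mat_pow A m $ i $ j = mat (\<xi> ^ m) $ i $ j" for i j
    using mat_pow_entry[OF assms(1), of k i j] u0 unfolding m assms(2) by (simp add: mat_entry)
  then show ?thesis by (simp add: vec_eq_iff)
qed

definition diag2 :: "complex \<Rightarrow> mat2" where
  "diag2 \<xi> = vector [vector [\<xi>, 0], vector [0, inverse \<xi>]]"

lemma diag2_entry [simp]:
  "diag2 \<xi> $ 1 $ 1 = \<xi>" "diag2 \<xi> $ 1 $ 2 = 0" "diag2 \<xi> $ 2 $ 1 = 0" "diag2 \<xi> $ 2 $ 2 = inverse \<xi>"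
  by (simp_all add: diag2_def)

lemma diag2_mult: "diag2 \<xi> ** diag2 \<eta> = diag2 (\<xi> * \<eta>)"
  by (simp add: vec_eq_iff forall_2 mat2_mult_entry)

lemma mat_pow_diag2: "mat_pow (diag2 \<xi>) k = diag2 (\<xi> ^ k)"
  by (induction k) (simp_all add: diag2_mult, simp add: vec_eq_iff forall_2 mat_entry)

lemma diag2_det_trace: "\<xi> \<noteq> 0 \<Longrightarrow> det (diag2 \<xi>) = 1" "trace (diag2 \<xi>) = joukowski \<xi>"
  by (simp_all add: det_2 trace2 joukowski_def)

text \<open>The diagonal entries of \<open>B\<close> are forced by the two traces, by a linear system of determinant
  \<open>\<xi> - inverse \<xi>\<close>; the off-diagonal entries only have to give determinant one.\<close>

lemma SL2_prescribed_traces: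
  assumes "\<xi> \<noteq> 0" "\<xi>\<^sup>2 \<noteq> 1"
  shows "\<exists>B. det B = 1 \<and> trace B = t \<and> trace (diag2 \<xi> ** B) = z"
proof -
  have ne: "\<xi> - inverse \<xi> \<noteq> 0" using assms by (metis eq_iff_diff_eq_0 power2_eq_square right_inverse)
  define p where "p = (z - t * inverse \<xi>) / (\<xi> - inverse \<xi>)"
  define B :: mat2 where "B = vector [vector [p, 1], vector [p * (t - p) - 1, t - p]]"
  have "p * (\<xi> - inverse \<xi>) = z - t * inverse \<xi>" using ne by (simp add: p_def)
  then have "\<xi> * p + inverse \<xi> * (t - p) = z" by (simp add: algebra_simps)
  then have "det B = 1 \<and> trace B = t \<and> trace (diag2 \<xi> ** B) = z"
    by (simp add: B_def det_2 trace2 mat2_mult_entry)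
  then show ?thesis by blast
qed

text \<open>The equation \<open>A ^ m = B ^ n\<close> is a linear relation between \<open>A\<close>, \<open>B\<close> and the identity. If the
  coefficient of \<open>A\<close> or of \<open>B\<close> is nonzero, one matrix is an affine function of the other and they
  have a common eigenvector. Otherwise both powers are the same scalar matrix, which says only
  that the eigenvalues are suitable roots of unity.\<close>

lemma equal_powers_trace_cases:
  assumes det: "det A = 1" "det B = 1" and pow: "mat_pow A m = mat_pow B n" and mn: "m \<ge> 1" "n \<ge> 1"
  shows "(\<exists>\<xi> \<eta>. (trace A, trace B, trace (A ** B)) = diag_char \<xi> \<eta> \<and> \<xi> \<noteq> 0 \<and> \<eta> \<noteq> 0 \<and> \<xi> ^ m = \<eta> ^ n)
    \<or> (\<exists>\<xi> \<eta>. trace A = joukowski \<xi> \<and> trace B = joukowski \<eta> \<and>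
          \<xi> ^ (2 * m) = 1 \<and> \<xi>\<^sup>2 \<noteq> 1 \<and> \<eta>\<^sup>2 \<noteq> 1 \<and> \<xi> ^ m = \<eta> ^ n)"
proof -
  obtain k l where m: "m = Suc k" and n: "n = Suc l"
    using mn by (metis One_nat_def Suc_le_D)
  define u u' w w' where "u = cheb (trace A) m" and "u' = cheb (trace A) k"
    and "w = cheb (trace B) n" and "w' = cheb (trace B) l"
  have entry: "u * A $ i $ j - u' * (mat 1 :: mat2) $ i $ j = w * B $ i $ j - w' * (mat 1 :: mat2) $ i $ j" for i j
    using mat_pow_entry[OF det(1), of k i j] mat_pow_entry[OF det(2), of l i j] pow
    unfolding m n u_def u'_def w_def w'_def by metis
  show ?thesis
  proof (cases "u = 0 \<and> w = 0")
    case False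
    have "\<exists>v \<xi> \<eta>. v \<noteq> 0 \<and> A *v v = \<xi> *s v \<and> B *v v = \<eta> *s v"
    proof (cases "u = 0")
      case False
      have "A $ i $ j = w / u * B $ i $ j + (u' - w') / u * (mat 1 :: mat2) $ i $ j" for i j
        using entry[of i j] False by (simp add: field_simps)
      then show ?thesis by (rule affine_common_eigenvector[OF det(2)])
    next
      case True
      with False have w: "w \<noteq> 0" by simp
      have "B $ i $ j = u / w * A $ i $ j + (w' - u') / w * (mat 1 :: mat2) $ i $ j" for i j
        using entry[of i j] w by (simp add: field_simps)
      from affine_common_eigenvector[OF det(1) this] show ?thesis by blast
    qed
    then show ?thesis using common_eigenvector_char[OF det pow] by blast
  next
    case True
    obtain \<xi> \<eta> where \<xi>: "\<xi> \<noteq> 0" "trace A = joukowski \<xi>" and \<eta>: "\<eta> \<noteq> 0" "trace B = joukowski \<eta>"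
      using joukowski_surj by metis
    have pw: "\<xi> ^ m = - u'" "inverse \<xi> ^ m = - u'" "\<eta> ^ n = - w'"
      using cheb_joukowski_power[OF \<xi>(1), of k] cheb_joukowski_power[of "inverse \<xi>" k]
        cheb_joukowski_power[OF \<eta>(1), of l] True \<xi> \<eta>
      by (simp_all add: u_def u'_def w_def w'_def m n)
    have "\<xi> ^ (2 * m) = \<xi> ^ m * inverse \<xi> ^ m" using pw by (simp add: mult_2 power_add)
    also have "\<dots> = 1" using \<xi>(1) by (simp add: power_inverse)
    finally have "\<xi> ^ (2 * m) = 1" .
    moreover have "\<xi>\<^sup>2 \<noteq> 1"
      using cheb_two[of \<xi> k] True \<xi> by (auto simp: u_def m simp del: of_nat_Suc)
    moreover have "\<eta>\<^sup>2 \<noteq> 1"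
      using cheb_two[of \<eta> l] True \<eta> by (auto simp: w_def n simp del: of_nat_Suc)
    moreover have "\<xi> ^ m = \<eta> ^ n"
      using entry[of 1 1] True by (simp add: pw mat_entry)
    ultimately show ?thesis using \<xi>(2) \<eta>(2) by blast
  qed
qed

text \<open>Reducible characters on the left; on the right the vertical lines, on which the traces of the
  generators are fixed and the trace of the product is arbitrary.\<close>

lemma char_variety_explicit:
  assumes "m \<ge> 1" "n \<ge> 1"
  shows "char_variety m n = {diag_char \<xi> \<eta> |\<xi> \<eta>. \<xi> \<noteq> 0 \<and> \<eta> \<noteq> 0 \<and> \<xi> ^ m = \<eta> ^ n} \<union>
    {(joukowski \<xi>, joukowski \<eta>, z) |\<xi> \<eta> z.
      \<xi> ^ (2 * m) = 1 \<and> \<xi>\<^sup>2 \<noteq> 1 \<and> \<eta>\<^sup>2 \<noteq> 1 \<and> \<xi> ^ m = \<eta> ^ n}" (is "_ = ?R \<union> ?I")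
proof (intro equalityI subsetI)
  fix p assume "p \<in> char_variety m n"
  then obtain A B where AB: "det A = 1" "det B = 1" "mat_pow A m = mat_pow B n"
    and p: "p = (trace A, trace B, trace (A ** B))"
    unfolding char_variety_eq_torus_pairs[OF assms] torus_pairs_def by auto
  show "p \<in> ?R \<union> ?I"
    using equal_powers_trace_cases[OF AB assms] unfolding p by blast
next
  fix p assume "p \<in> ?R \<union> ?I"
  then show "p \<in> char_variety m n"
  proof
    assume "p \<in> ?R"
    then obtain \<xi> \<eta> where "\<xi> \<noteq> 0" "\<eta> \<noteq> 0" "\<xi> ^ m = \<eta> ^ n" "p = diag_char \<xi> \<eta>" by blast
    then show ?thesis
      unfolding char_variety_eq_torus_pairs[OF assms]
      by (intro image_eqI[of _ _ "(diag2 \<xi>, diag2 \<eta>)"])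
         (simp_all add: diag_char_def torus_pairs_def diag2_det_trace diag2_mult mat_pow_diag2)
  next
    assume "p \<in> ?I"
    then obtain \<xi> \<eta> z where p: "p = (joukowski \<xi>, joukowski \<eta>, z)"
      and *: "\<xi> ^ (2 * m) = 1" "\<xi>\<^sup>2 \<noteq> 1" "\<eta>\<^sup>2 \<noteq> 1" "\<xi> ^ m = \<eta> ^ n" by blast
    have nz: "\<xi> \<noteq> 0" using *(1) assms(1) by (auto simp: power_0_left)
    have "\<eta> ^ (2 * n) = 1" using *(1,4) by (simp add: mult_2 power_add)
    obtain B where B: "det B = 1" "trace B = joukowski \<eta>" "trace (diag2 \<xi> ** B) = z"
      using SL2_prescribed_traces[OF nz *(2)] by metis
    have "mat_pow (diag2 \<xi>) m = mat_pow B n"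
      using SL2_power_scalar[OF diag2_det_trace(1)[OF nz] diag2_det_trace(2) *(2,1) assms(1)]
        SL2_power_scalar[OF B(1,2) *(3) \<open>\<eta> ^ (2 * n) = 1\<close> assms(2)] *(4) by simp
    then show ?thesis
      unfolding char_variety_eq_torus_pairs[OF assms] p
      by (intro image_eqI[of _ _ "(diag2 \<xi>, B)"])
         (simp_all add: torus_pairs_def diag2_det_trace nz B)
  qed
qed

section \<open>Components and their intersections\<close>

text \<open>Indexing by integers modulo \<open>2 * d\<close> covers both \<open>1\<close> and \<open>- 1\<close> as \<open>d\<close>-th powers.\<close>

definition unit_root :: "nat \<Rightarrow> int \<Rightarrow> complex" where
  "unit_root d r = cis (pi * of_int r / of_nat d)"

lemma unit_root_nonzero [simp]: "unit_root d r \<noteq> 0"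
  by (simp add: unit_root_def)

lemma unit_root_add: "unit_root d (r + s) = unit_root d r * unit_root d s"
  by (simp add: unit_root_def cis_mult add_divide_distrib[symmetric] distrib_left)

lemma unit_root_minus: "unit_root d (- r) = inverse (unit_root d r)"
  by (simp add: unit_root_def)

lemma unit_root_power: "a \<ge> 1 \<Longrightarrow> unit_root (d * a) r ^ a = unit_root d r"
  unfolding unit_root_def Complex.DeMoivre by (intro arg_cong[of _ _ cis]) (simp add: field_simps)

lemma unit_root_eq_1_iff:
  assumes "d \<ge> 1"
  shows "unit_root d r = 1 \<longleftrightarrow> 2 * int d dvd r"
proof
  assume "unit_root d r = 1"
  then obtain k :: int where "pi * of_int r / of_nat d = of_int (2 * k) * pi"
    unfolding unit_root_def cis_eq_1_iff by (auto simp: mult_ac)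
  then have "real_of_int r = real_of_int (2 * int d * k)" using assms by (simp add: field_simps)
  then show "2 * int d dvd r" by (metis dvd_triv_left of_int_eq_iff)
next
  assume "2 * int d dvd r"
  then obtain k where "r = 2 * int d * k" by blast
  then have "pi * of_int r / of_nat d = 2 * pi * of_int k" using assms by (simp add: field_simps)
  then show "unit_root d r = 1" by (simp add: unit_root_def cis_multiple_2pi)
qed

lemma unit_root_eq_iff:
  assumes "d \<ge> 1"
  shows "unit_root d r = unit_root d s \<longleftrightarrow> 2 * int d dvd r - s"
proof -
  have "unit_root d (r - s) = unit_root d r / unit_root d s"
    using unit_root_add[of d r "- s"] by (simp add: unit_root_minus divide_inverse)
  then show ?thesis using unit_root_eq_1_iff[OF assms, of "r - s"] by auto
qed

lemma joukowski_unit_root_eq_iff: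
  assumes "d \<ge> 1"
  shows "joukowski (unit_root d r) = joukowski (unit_root d s)
    \<longleftrightarrow> 2 * int d dvd r - s \<or> 2 * int d dvd r + s"
  using unit_root_eq_iff[OF assms, of r s] unit_root_eq_iff[OF assms, of r "- s"]
  by (simp add: joukowski_eq_iff unit_root_minus)

lemma root_of_unity_is_unit_root:
  assumes "z ^ (2 * d) = 1" "d \<ge> 1"
  shows "\<exists>r. r < 2 * d \<and> z = unit_root d (int r)"
proof -
  have "bij_betw (\<lambda>k. cis (2 * pi * real k / real (2 * d))) {..<2 * d} {z. z ^ (2 * d) = 1}"
    by (rule Complex.bij_betw_roots_unity) (use assms in simp)
  then obtain r where "r < 2 * d" "z = cis (2 * pi * real r / real (2 * d))"
    using assms(1) unfolding bij_betw_def by (metis (mono_tags, lifting) imageE lessThan_iff mem_Collect_eq)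
  then show ?thesis by (intro exI[of _ r]) (simp add: unit_root_def)
qed

text \<open>Replacing a root of unity in the lower half plane by its inverse does not change its trace.\<close>

lemma joukowski_half_root:
  assumes "\<xi> ^ (2 * m) = 1" "\<xi>\<^sup>2 \<noteq> 1" "m \<ge> 1"
  shows "\<exists>k. 0 < k \<and> k < m \<and> joukowski \<xi> = joukowski (unit_root m (int k)) \<and> \<xi> ^ m = unit_root 1 (int k)"
proof -
  obtain r where r: "r < 2 * m" "\<xi> = unit_root m (int r)"
    using root_of_unity_is_unit_root[OF assms(1,3)] by blast
  have pw: "\<xi> ^ m = unit_root 1 (int r)" using unit_root_power[OF assms(3), of 1 "int r"] r by simp
  have "\<xi>\<^sup>2 = unit_root m (2 * int r)"
    unfolding power2_eq_square r(2) unit_root_add[symmetric] by simp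
  then have "\<not> 2 * int m dvd 2 * int r" using unit_root_eq_1_iff[OF assms(3)] assms(2) by simp
  then have "\<not> m dvd r" by simp
  then have ne: "r \<noteq> 0" "r \<noteq> m" by (metis dvd_0_right, metis dvd_refl)
  show ?thesis
  proof (cases "r < m")
    case True
    then show ?thesis using ne r(2) pw by blast
  next
    case False
    have "2 * int m dvd int r + int (2 * m - r)" using r(1) by (simp add: of_nat_diff)
    then have "joukowski \<xi> = joukowski (unit_root m (int (2 * m - r)))"
      using joukowski_unit_root_eq_iff[OF assms(3)] r(2) by blast
    moreover have "unit_root 1 (int r) = unit_root 1 (int (2 * m - r))"
      using r(1) by (subst unit_root_eq_iff) (simp_all add: of_nat_diff)
    ultimately show ?thesis using False ne r(1) pw by (intro exI[of _ "2 * m - r"]) auto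
  qed
qed

lemma diag_char_inverse: "diag_char (inverse \<xi>) (inverse \<eta>) = diag_char \<xi> \<eta>"
  by (simp add: diag_char_def inverse_mult_distrib[symmetric] del: inverse_mult_distrib)

lemma joukowski_mult:
  "\<xi> \<noteq> 0 \<Longrightarrow> \<eta> \<noteq> 0 \<Longrightarrow> joukowski \<xi> * joukowski \<eta> = joukowski (\<xi> * \<eta>) + joukowski (\<xi> * inverse \<eta>)"
  by (simp add: joukowski_def algebra_simps)

text \<open>Fricke's expression for \<open>trace (A B A\<^sup>-\<^sup>1 B\<^sup>-\<^sup>1) - 2\<close> in terms of the traces of \<open>A\<close>, \<open>B\<close> and \<open>A B\<close>; it
  vanishes exactly on the characters of reducible pairs.\<close>

definition fricke_form :: "complex \<times> complex \<times> complex \<Rightarrow> complex" where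
  "fricke_form = (\<lambda>(x, y, z). x * x + y * y + z * z - x * y * z - 4)"

lemma fricke_form_zero_iff:
  "fricke_form p = 0 \<longleftrightarrow> (\<exists>\<xi> \<eta>. \<xi> \<noteq> 0 \<and> \<eta> \<noteq> 0 \<and> p = diag_char \<xi> \<eta>)"
proof -
  obtain x y z where p: "p = (x, y, z)" by (cases p)
  have factor: "fricke_form (joukowski \<xi>, joukowski \<eta>, z)
      = (z - joukowski (\<xi> * \<eta>)) * (z - joukowski (\<xi> * inverse \<eta>))" if "\<xi> \<noteq> 0" "\<eta> \<noteq> 0" for \<xi> \<eta> z
    using that by (simp add: fricke_form_def joukowski_def field_simps) 
  show ?thesis
  proof
    assume *: "fricke_form p = 0"
    obtain \<xi> \<eta> where nz: "\<xi> \<noteq> 0" "\<eta> \<noteq> 0" and xy: "x = joukowski \<xi>" "y = joukowski \<eta>"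
      using joukowski_surj by metis
    then have "z = joukowski (\<xi> * \<eta>) \<or> z = joukowski (\<xi> * inverse \<eta>)"
      using * factor[OF nz, of z] by (simp add: p)
    then have "p = diag_char \<xi> \<eta> \<or> p = diag_char \<xi> (inverse \<eta>)"
      by (auto simp: diag_char_def p xy)
    then show "\<exists>\<xi> \<eta>. \<xi> \<noteq> 0 \<and> \<eta> \<noteq> 0 \<and> p = diag_char \<xi> \<eta>"
      using nz by (metis inverse_nonzero_iff_nonzero)
  next
    assume "\<exists>\<xi> \<eta>. \<xi> \<noteq> 0 \<and> \<eta> \<noteq> 0 \<and> p = diag_char \<xi> \<eta>"
    then show "fricke_form p = 0" using factor by (auto simp: diag_char_def)
  qed
qed

lemma polynomial_function_fricke_form: "polynomial_function fricke_form"
proof -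
  have "polynomial_function (\<lambda>p. fst p * fst p + fst (snd p) * fst (snd p) + snd (snd p) * snd (snd p)
      - fst p * fst (snd p) * snd (snd p) - 4)"
    by (intro polynomial_function_diff polynomial_function_intros)
  also have "(\<lambda>p. fst p * fst p + fst (snd p) * fst (snd p) + snd (snd p) * snd (snd p)
      - fst p * fst (snd p) * snd (snd p) - 4) = fricke_form"
    by (auto simp: fricke_form_def)
  finally show ?thesis .
qed

text \<open>The traces of words in two commuting matrices are polynomials in the three coordinates, by the
  recursion \<open>tr (g\<^sup>2 h) = tr g \<cdot> tr (g h) - tr h\<close>. For suitable exponents such a trace separates the curves of
  reducible characters from each other.\<close>

lemma monomial_trace_polynomial:
  "\<exists>g. polynomial_function g \<and> (\<forall>\<xi> \<eta>. \<xi> \<noteq> 0 \<longrightarrow> \<eta> \<noteq> 0 \<longrightarrow>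
    g (diag_char \<xi> \<eta>) = joukowski (\<xi> ^ j * inverse (\<eta> ^ k)))" (is "?P j k")
proof -
  have base: "?P 0 k" for k
  proof (induction k rule: induct_nat_012)
    case 0
    show ?case by (intro exI[of _ "\<lambda>p. 2"]) (simp add: polynomial_function_intros joukowski_def)
  next
    case 1
    show ?case by (intro exI[of _ "\<lambda>p. fst (snd p)"]) (simp add: polynomial_function_intros diag_char_def)
  next
    case (ge2 k)
    then obtain g h where gh: "polynomial_function g" "polynomial_function h"
      "\<And>\<xi> \<eta>. \<xi> \<noteq> 0 \<Longrightarrow> \<eta> \<noteq> 0 \<Longrightarrow> g (diag_char \<xi> \<eta>) = joukowski (\<xi> ^ 0 * inverse (\<eta> ^ k))"
      "\<And>\<xi> \<eta>. \<xi> \<noteq> 0 \<Longrightarrow> \<eta> \<noteq> 0 \<Longrightarrow> h (diag_char \<xi> \<eta>) = joukowski (\<xi> ^ 0 * inverse (\<eta> ^ Suc k))"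
      by blast
    show ?case
    proof (intro exI[of _ "\<lambda>p. fst (snd p) * h p - g p"] conjI allI impI)
      show "polynomial_function (\<lambda>p. fst (snd p) * h p - g p)"
        by (intro polynomial_function_diff polynomial_function_intros gh)
      fix \<xi> \<eta> :: complex assume nz: "\<xi> \<noteq> 0" "\<eta> \<noteq> 0"
      show "fst (snd (diag_char \<xi> \<eta>)) * h (diag_char \<xi> \<eta>) - g (diag_char \<xi> \<eta>)
          = joukowski (\<xi> ^ 0 * inverse (\<eta> ^ Suc (Suc k)))"
        unfolding gh(3,4)[OF nz] using nz by (simp add: diag_char_def joukowski_def field_simps)
    qed
  qed
  have base': "?P 1 k" for k
  proof (induction k rule: induct_nat_012)
    case 0
    show ?case by (intro exI[of _ fst]) (simp add: polynomial_function_intros diag_char_def)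
  next
    case 1
    show ?case
    proof (intro exI[of _ "\<lambda>p. fst p * fst (snd p) - snd (snd p)"] conjI allI impI)
      show "polynomial_function (\<lambda>p. fst p * fst (snd p) - snd (snd p))"
        by (intro polynomial_function_diff polynomial_function_intros)
      fix \<xi> \<eta> :: complex assume nz: "\<xi> \<noteq> 0" "\<eta> \<noteq> 0"
      show "fst (diag_char \<xi> \<eta>) * fst (snd (diag_char \<xi> \<eta>)) - snd (snd (diag_char \<xi> \<eta>))
          = joukowski (\<xi> ^ 1 * inverse (\<eta> ^ Suc 0))"
        using joukowski_mult[OF nz] by (simp add: diag_char_def)
    qed
  next
    case (ge2 k)
    then obtain g h where gh: "polynomial_function g" "polynomial_function h"
      "\<And>\<xi> \<eta>. \<xi> \<noteq> 0 \<Longrightarrow> \<eta> \<noteq> 0 \<Longrightarrow> g (diag_char \<xi> \<eta>) = joukowski (\<xi> ^ 1 * inverse (\<eta> ^ k))"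
      "\<And>\<xi> \<eta>. \<xi> \<noteq> 0 \<Longrightarrow> \<eta> \<noteq> 0 \<Longrightarrow> h (diag_char \<xi> \<eta>) = joukowski (\<xi> ^ 1 * inverse (\<eta> ^ Suc k))"
      by blast
    show ?case
    proof (intro exI[of _ "\<lambda>p. fst (snd p) * h p - g p"] conjI allI impI)
      show "polynomial_function (\<lambda>p. fst (snd p) * h p - g p)"
        by (intro polynomial_function_diff polynomial_function_intros gh)
      fix \<xi> \<eta> :: complex assume nz: "\<xi> \<noteq> 0" "\<eta> \<noteq> 0"
      show "fst (snd (diag_char \<xi> \<eta>)) * h (diag_char \<xi> \<eta>) - g (diag_char \<xi> \<eta>)
          = joukowski (\<xi> ^ 1 * inverse (\<eta> ^ Suc (Suc k)))"
        unfolding gh(3,4)[OF nz] using nz by (simp add: diag_char_def joukowski_def field_simps)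
    qed
  qed
  show ?thesis
  proof (induction j rule: induct_nat_012)
    case (ge2 j)
    then obtain g h where gh: "polynomial_function g" "polynomial_function h"
      "\<And>\<xi> \<eta>. \<xi> \<noteq> 0 \<Longrightarrow> \<eta> \<noteq> 0 \<Longrightarrow> g (diag_char \<xi> \<eta>) = joukowski (\<xi> ^ j * inverse (\<eta> ^ k))"
      "\<And>\<xi> \<eta>. \<xi> \<noteq> 0 \<Longrightarrow> \<eta> \<noteq> 0 \<Longrightarrow> h (diag_char \<xi> \<eta>) = joukowski (\<xi> ^ Suc j * inverse (\<eta> ^ k))"
      by blast
    show ?case
    proof (intro exI[of _ "\<lambda>p. fst p * h p - g p"] conjI allI impI)
      show "polynomial_function (\<lambda>p. fst p * h p - g p)"
        by (intro polynomial_function_diff polynomial_function_intros gh)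
      fix \<xi> \<eta> :: complex assume nz: "\<xi> \<noteq> 0" "\<eta> \<noteq> 0"
      show "fst (diag_char \<xi> \<eta>) * h (diag_char \<xi> \<eta>) - g (diag_char \<xi> \<eta>)
          = joukowski (\<xi> ^ Suc (Suc j) * inverse (\<eta> ^ k))"
        unfolding gh(3,4)[OF nz] using nz by (simp add: diag_char_def joukowski_def field_simps)
    qed
  qed (use base base' in simp_all)
qed

text \<open>With \<open>u a + v b = 1\<close> the parameter is \<open>\<eta>\<^sup>u \<xi>\<^sup>v\<close>.\<close>

lemma coprime_powers_parametrise:
  fixes \<xi> \<eta> :: complex
  assumes "coprime a b" "\<xi> \<noteq> 0" "\<eta> \<noteq> 0" "\<xi> ^ a = \<eta> ^ b"
  shows "\<exists>t. t \<noteq> 0 \<and> \<xi> = t ^ b \<and> \<eta> = t ^ a"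
proof -
  obtain u v where uv: "u * int a + v * int b = 1"
    using bezout_int[of "int a" "int b"] assms(1) by auto
  define t where "t = \<eta> powi u * \<xi> powi v"
  have pw: "\<xi> powi (int a * k) = \<eta> powi (int b * k)" for k
    using assms(4) by (simp add: power_int_mult)
  have "t ^ a = \<eta> powi (u * int a) * \<xi> powi (int a * v)"
    by (simp add: t_def power_mult_distrib power_int_mult) (metis power_int_mult power_int_of_nat mult.commute)
  also have "\<dots> = \<eta> powi (u * int a + v * int b)"
    using assms(3) by (simp add: pw power_int_add mult.commute[of v])
  finally have "t ^ a = \<eta>" by (simp add: uv)
  moreover have "t ^ b = \<eta> powi (int b * u) * \<xi> powi (v * int b)"
    by (simp add: t_def power_mult_distrib power_int_mult) (metis power_int_mult power_int_of_nat mult.commute)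
  then have "t ^ b = \<xi> powi (u * int a + v * int b)"
    using assms(2) by (simp add: pw[symmetric] power_int_add mult.commute[of u])
  then have "t ^ b = \<xi>" by (simp add: uv)
  moreover have "t \<noteq> 0" using assms(2,3) by (simp add: t_def power_int_eq_0_iff)
  ultimately show ?thesis by metis
qed

lemma laurent_function_joukowski_monomial: "laurent_function (\<lambda>t. joukowski (c * t ^ k))"
proof -
  have "laurent_function (\<lambda>t. c * t ^ k + inverse c * inverse (t ^ k))"
    by (intro laurent_function_add laurent_function_mult laurent_function_const
        laurent_function_power laurent_function_inverse_power)
  then show ?thesis by (simp add: joukowski_def)
qed

text \<open>The pair is written as \<open>m = d a\<close>, \<open>n = d b\<close> with \<open>d\<close> the greatest common divisor.\<close>

locale torus_data =
  fixes d a b :: nat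
  assumes pos: "d \<ge> 1" "a \<ge> 1" "b \<ge> 1" and coprime: "coprime a b"
begin

definition line :: "nat \<times> nat \<Rightarrow> (complex \<times> complex \<times> complex) set" where
  "line = (\<lambda>(k, l). {(joukowski (unit_root (d * a) (int k)), joukowski (unit_root (d * b) (int l)), z) |z. True})"

text \<open>The equation \<open>\<xi>\<^sup>d\<^sup>a = \<eta>\<^sup>d\<^sup>b\<close> splits into \<open>\<xi>\<^sup>a = \<zeta> \<eta>\<^sup>b\<close> for the \<open>d\<close>-th roots of unity \<open>\<zeta>\<close>. Inverting both
  \<open>\<xi>\<close> and \<open>\<eta>\<close> identifies \<open>\<zeta>\<close> with its inverse, so the indices \<open>0, \<dots>, d div 2\<close> suffice.\<close>

definition curve :: "nat \<Rightarrow> (complex \<times> complex \<times> complex) set" where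
  "curve i = {diag_char \<xi> \<eta> |\<xi> \<eta>. \<xi> \<noteq> 0 \<and> \<eta> \<noteq> 0 \<and> \<xi> ^ a = unit_root d (2 * int i) * \<eta> ^ b}"

definition line_index :: "(nat \<times> nat) set" where
  "line_index = {(k, l). 0 < k \<and> k < d * a \<and> 0 < l \<and> l < d * b \<and> even (k + l)}"

definition curve_index :: "nat set" where
  "curve_index = {..d div 2}"

lemma da_pos: "d * a \<ge> 1" "d * b \<ge> 1"
  using pos by simp_all

lemma curve_trace_function:
  "\<exists>g. polynomial_function g \<and> (\<forall>\<xi> \<eta>. \<xi> \<noteq> 0 \<longrightarrow> \<eta> \<noteq> 0 \<longrightarrow>
    g (diag_char \<xi> \<eta>) = joukowski (\<xi> ^ a * inverse (\<eta> ^ b)))"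
  by (rule monomial_trace_polynomial)

text \<open>The condition is invariant under the ambiguity in \<open>\<xi>\<close> and \<open>\<eta>\<close>, because its left hand side is a
  polynomial in the character.\<close>

lemma diag_char_in_curve_iff:
  assumes nz: "\<xi> \<noteq> 0" "\<eta> \<noteq> 0"
  shows "diag_char \<xi> \<eta> \<in> curve i \<longleftrightarrow>
    joukowski (\<xi> ^ a * inverse (\<eta> ^ b)) = joukowski (unit_root d (2 * int i))"
proof
  obtain g where g: "\<And>\<xi> \<eta>. \<xi> \<noteq> 0 \<Longrightarrow> \<eta> \<noteq> 0 \<Longrightarrow> g (diag_char \<xi> \<eta>) = joukowski (\<xi> ^ a * inverse (\<eta> ^ b))"
    using curve_trace_function by blast
  assume "diag_char \<xi> \<eta> \<in> curve i"
  then obtain \<xi>' \<eta>' where *: "diag_char \<xi> \<eta> = diag_char \<xi>' \<eta>'" "\<xi>' \<noteq> 0" "\<eta>' \<noteq> 0"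
      "\<xi>' ^ a = unit_root d (2 * int i) * \<eta>' ^ b"
    unfolding curve_def by blast
  have "joukowski (\<xi> ^ a * inverse (\<eta> ^ b)) = joukowski (\<xi>' ^ a * inverse (\<eta>' ^ b))"
    using g[OF nz] g[OF *(2,3)] *(1) by simp
  also have "\<xi>' ^ a * inverse (\<eta>' ^ b) = unit_root d (2 * int i)"
    using *(3,4) by simp
  finally show "joukowski (\<xi> ^ a * inverse (\<eta> ^ b)) = joukowski (unit_root d (2 * int i))" .
next
  assume *: "joukowski (\<xi> ^ a * inverse (\<eta> ^ b)) = joukowski (unit_root d (2 * int i))"
  have "\<xi> ^ a * inverse (\<eta> ^ b) = unit_root d (2 * int i)
      \<or> \<xi> ^ a * inverse (\<eta> ^ b) = inverse (unit_root d (2 * int i))"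
    using * nz joukowski_eq_iff[of "\<xi> ^ a * inverse (\<eta> ^ b)"] by simp
  then show "diag_char \<xi> \<eta> \<in> curve i"
  proof
    assume "\<xi> ^ a * inverse (\<eta> ^ b) = unit_root d (2 * int i)"
    then have "\<xi> ^ a = unit_root d (2 * int i) * \<eta> ^ b" using nz by (simp add: field_simps)
    then show ?thesis unfolding curve_def using nz by blast
  next
    assume "\<xi> ^ a * inverse (\<eta> ^ b) = inverse (unit_root d (2 * int i))"
    then have "inverse \<xi> ^ a = unit_root d (2 * int i) * inverse \<eta> ^ b"
      using nz by (simp add: field_simps)
    then have "diag_char (inverse \<xi>) (inverse \<eta>) \<in> curve i"
      unfolding curve_def using nz by (metis (mono_tags, lifting) inverse_nonzero_iff_nonzero mem_Collect_eq)
    then show ?thesis by (simp only: diag_char_inverse)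
  qed
qed

lemma algebraic_curve: "algebraic_set (curve i)"
proof -
  obtain g where pg: "polynomial_function g"
    and g: "\<And>\<xi> \<eta>. \<xi> \<noteq> 0 \<Longrightarrow> \<eta> \<noteq> 0 \<Longrightarrow> g (diag_char \<xi> \<eta>) = joukowski (\<xi> ^ a * inverse (\<eta> ^ b))"
    using curve_trace_function by blast
  define c where "c = joukowski (unit_root d (2 * int i))"
  have "curve i = {p. fricke_form p = 0} \<inter> {p. g p - c = 0}"
  proof (intro equalityI subsetI)
    fix p assume p: "p \<in> curve i"
    then obtain \<xi> \<eta> where nz: "\<xi> \<noteq> 0" "\<eta> \<noteq> 0" "p = diag_char \<xi> \<eta>"
      unfolding curve_def by blast
    then show "p \<in> {p. fricke_form p = 0} \<inter> {p. g p - c = 0}"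
      using p diag_char_in_curve_iff[OF nz(1,2), of i] g[OF nz(1,2)]
      by (auto simp: fricke_form_zero_iff c_def)
  next
    fix p assume p: "p \<in> {p. fricke_form p = 0} \<inter> {p. g p - c = 0}"
    then obtain \<xi> \<eta> where nz: "\<xi> \<noteq> 0" "\<eta> \<noteq> 0" "p = diag_char \<xi> \<eta>"
      using fricke_form_zero_iff by blast
    then show "p \<in> curve i"
      using p diag_char_in_curve_iff[OF nz(1,2), of i] g[OF nz(1,2)] by (simp add: c_def)
  qed
  moreover have "algebraic_set ({p. fricke_form p = 0} \<inter> {p. g p - c = 0})"
    by (intro algebraic_set_Int algebraic_set_zeros polynomial_function_fricke_form
        polynomial_function_diff pg polynomial_function_intros)
  ultimately show ?thesis by simp
qed

lemma irreducible_curve: "irreducible_algebraic_set (curve i)"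
proof -
  \<comment> \<open>An \<open>a\<close>-th root of the constant in the equation of the curve, which reduces it to \<open>\<xi>\<^sup>a = \<eta>\<^sup>b\<close>.\<close>
  define c where "c = unit_root (d * a) (2 * int i)"
  have c: "c \<noteq> 0" "c ^ a = unit_root d (2 * int i)"
    using unit_root_power[OF pos(2)] by (simp_all add: c_def)
  have "curve i = (\<lambda>t. diag_char (c * t ^ b) (t ^ a)) ` (- {0})"
  proof (intro equalityI subsetI)
    fix p assume "p \<in> curve i"
    then obtain \<xi> \<eta> where nz: "\<xi> \<noteq> 0" "\<eta> \<noteq> 0" and p: "p = diag_char \<xi> \<eta>"
      and eq: "\<xi> ^ a = unit_root d (2 * int i) * \<eta> ^ b" unfolding curve_def by blast
    have "(\<xi> / c) ^ a = \<eta> ^ b" using eq c by (simp add: power_divide)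
    then obtain t where "t \<noteq> 0" "\<xi> / c = t ^ b" "\<eta> = t ^ a"
      using coprime_powers_parametrise[OF coprime, of "\<xi> / c" \<eta>] nz c by auto
    then show "p \<in> (\<lambda>t. diag_char (c * t ^ b) (t ^ a)) ` (- {0})"
      using c by (intro image_eqI[of _ _ t]) (auto simp: p field_simps)
  next
    fix p assume "p \<in> (\<lambda>t. diag_char (c * t ^ b) (t ^ a)) ` (- {0})"
    then obtain t where t: "t \<noteq> 0" "p = diag_char (c * t ^ b) (t ^ a)" by blast
    have "(c * t ^ b) ^ a = unit_root d (2 * int i) * (t ^ a) ^ b"
      by (simp add: power_mult_distrib c power_mult[symmetric] mult.commute)
    moreover have "c * t ^ b \<noteq> 0" "t ^ a \<noteq> 0" using t c by simp_all
    ultimately show "p \<in> curve i" unfolding curve_def t(2) by blast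
  qed
  also have "\<dots> = (\<lambda>t. (joukowski (c * t ^ b), joukowski (1 * t ^ a), joukowski (c * t ^ (b + a)))) ` (- {0})"
    by (simp add: diag_char_def power_add mult_ac)
  finally show ?thesis
    by (rule irreducible_laurent_image[OF algebraic_curve])
       (rule laurent_function_joukowski_monomial)+
qed

lemma irreducible_line: "irreducible_algebraic_set (line v)"
proof -
  obtain k l where v: "v = (k, l)" by (cases v)
  define s t where "s = joukowski (unit_root (d * a) (int k))" and "t = joukowski (unit_root (d * b) (int l))"
  have line: "line v = {(s, t, z) |z. True}" by (simp add: line_def v s_def t_def)
  have "line v = {p. fst p - s = 0} \<inter> {p. fst (snd p) - t = 0}"
    unfolding line by auto
  moreover have "algebraic_set ({p. fst p - s = 0} \<inter> {p. fst (snd p) - t = 0})"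
    by (intro algebraic_set_Int algebraic_set_zeros polynomial_function_diff polynomial_function_intros)
  ultimately have alg: "algebraic_set (line v)" by simp
  have "line v = (\<lambda>z. (s, t, joukowski (1 * z ^ 1))) ` (- {0})"
  proof (intro equalityI subsetI)
    fix p assume "p \<in> line v"
    then obtain z where p: "p = (s, t, z)" unfolding line by blast
    obtain w where "w \<noteq> 0" "joukowski w = z" using joukowski_surj by blast
    then show "p \<in> (\<lambda>z. (s, t, joukowski (1 * z ^ 1))) ` (- {0})" using p by auto
  qed (auto simp: line)
  then show ?thesis
    by (rule irreducible_laurent_image[OF alg])
       (rule laurent_function_joukowski_monomial laurent_function_const)+
qed

lemma Union_curves:
  "{diag_char \<xi> \<eta> |\<xi> \<eta>. \<xi> \<noteq> 0 \<and> \<eta> \<noteq> 0 \<and> \<xi> ^ (d * a) = \<eta> ^ (d * b)} = \<Union> (curve ` curve_index)"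
proof (intro equalityI subsetI)
  fix p assume "p \<in> {diag_char \<xi> \<eta> |\<xi> \<eta>. \<xi> \<noteq> 0 \<and> \<eta> \<noteq> 0 \<and> \<xi> ^ (d * a) = \<eta> ^ (d * b)}"
  then obtain \<xi> \<eta> where nz: "\<xi> \<noteq> 0" "\<eta> \<noteq> 0" and p: "p = diag_char \<xi> \<eta>"
    and eq: "\<xi> ^ (d * a) = \<eta> ^ (d * b)" by blast
  define w where "w = \<xi> ^ a * inverse (\<eta> ^ b)"
  have "w ^ d = 1"
    using eq nz by (simp add: w_def power_mult_distrib power_inverse power_mult[symmetric] mult.commute)
  moreover have "bij_betw (\<lambda>k. cis (2 * pi * real k / real d)) {..<d} {z. z ^ d = 1}"
    by (rule Complex.bij_betw_roots_unity) (use pos in simp)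
  ultimately obtain r where r: "r < d" "w = cis (2 * pi * real r / real d)"
    unfolding bij_betw_def by (metis (mono_tags, lifting) imageE lessThan_iff mem_Collect_eq)
  then have w: "w = unit_root d (2 * int r)" by (simp add: unit_root_def mult_ac)
  define i where "i = (if r \<le> d div 2 then r else d - r)"
  have i: "i \<in> curve_index" using r(1) by (auto simp: i_def curve_index_def)
  have "2 * int d dvd 2 * int r - 2 * int i \<or> 2 * int d dvd 2 * int r + 2 * int i"
    using r(1) by (auto simp: i_def of_nat_diff)
  then have "joukowski w = joukowski (unit_root d (2 * int i))"
    using joukowski_unit_root_eq_iff[OF pos(1)] w by blast
  then have "p \<in> curve i" using diag_char_in_curve_iff[OF nz] by (simp add: p w_def)
  then show "p \<in> \<Union> (curve ` curve_index)" using i by blast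
next
  fix p assume "p \<in> \<Union> (curve ` curve_index)"
  then obtain \<xi> \<eta> i where nz: "\<xi> \<noteq> 0" "\<eta> \<noteq> 0" and p: "p = diag_char \<xi> \<eta>"
    and eq: "\<xi> ^ a = unit_root d (2 * int i) * \<eta> ^ b" unfolding curve_def by blast
  have "unit_root d (2 * int i) ^ d = 1"
    using unit_root_power[OF pos(1), of 1] unit_root_eq_1_iff[of 1 "2 * int i"] by simp
  then have "(\<xi> ^ a) ^ d = (\<eta> ^ b) ^ d" by (simp add: eq power_mult_distrib)
  then have "\<xi> ^ (d * a) = \<eta> ^ (d * b)" by (simp add: power_mult[symmetric] mult.commute)
  then show "p \<in> {diag_char \<xi> \<eta> |\<xi> \<eta>. \<xi> \<noteq> 0 \<and> \<eta> \<noteq> 0 \<and> \<xi> ^ (d * a) = \<eta> ^ (d * b)}"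
    using nz p by blast
qed

lemma Union_lines:
  "{(joukowski \<xi>, joukowski \<eta>, z) |\<xi> \<eta> z. \<xi> ^ (2 * (d * a)) = 1 \<and> \<xi>\<^sup>2 \<noteq> 1 \<and> \<eta>\<^sup>2 \<noteq> 1 \<and>
      \<xi> ^ (d * a) = \<eta> ^ (d * b)} = \<Union> (line ` line_index)" (is "?I = _")
proof (intro equalityI subsetI)
  fix p assume "p \<in> ?I"
  then obtain \<xi> \<eta> z where p: "p = (joukowski \<xi>, joukowski \<eta>, z)"
    and *: "\<xi> ^ (2 * (d * a)) = 1" "\<xi>\<^sup>2 \<noteq> 1" "\<eta>\<^sup>2 \<noteq> 1" "\<xi> ^ (d * a) = \<eta> ^ (d * b)" by blast
  have "\<eta> ^ (2 * (d * b)) = (\<eta> ^ (d * b))\<^sup>2" by (simp only: power_mult[symmetric] mult.commute)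
  also have "\<dots> = \<xi> ^ (2 * (d * a))" unfolding *(4)[symmetric] by (simp only: power_mult[symmetric] mult.commute)
  finally have \<eta>: "\<eta> ^ (2 * (d * b)) = 1" using *(1) by simp
  obtain k where k: "0 < k" "k < d * a" "joukowski \<xi> = joukowski (unit_root (d * a) (int k))"
      "\<xi> ^ (d * a) = unit_root 1 (int k)"
    using joukowski_half_root[OF *(1,2) da_pos(1)] by blast
  obtain l where l: "0 < l" "l < d * b" "joukowski \<eta> = joukowski (unit_root (d * b) (int l))"
      "\<eta> ^ (d * b) = unit_root 1 (int l)"
    using joukowski_half_root[OF \<eta> *(3) da_pos(2)] by blast
  have "2 dvd int k - int l" using k(4) l(4) *(4) unit_root_eq_iff[of 1] by simp
  then have "even (k + l)" by simp
  then have "(k, l) \<in> line_index" using k l by (simp add: line_index_def)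
  moreover have "p \<in> line (k, l)" using k l p by (simp add: line_def)
  ultimately show "p \<in> \<Union> (line ` line_index)" by blast
next
  fix p assume "p \<in> \<Union> (line ` line_index)"
  then obtain k l z where kl: "0 < k" "k < d * a" "0 < l" "l < d * b" "even (k + l)"
    and p: "p = (joukowski (unit_root (d * a) (int k)), joukowski (unit_root (d * b) (int l)), z)"
    by (auto simp: line_def line_index_def)
  let ?\<xi> = "unit_root (d * a) (int k)" and ?\<eta> = "unit_root (d * b) (int l)"
  have sq: "(unit_root m (int k))\<^sup>2 \<noteq> 1" if "0 < k" "k < m" for m k
  proof -
    have "(unit_root m (int k))\<^sup>2 = unit_root m (2 * int k)"
      unfolding power2_eq_square unit_root_add[symmetric] by simp
    moreover have "\<not> 2 * int m dvd 2 * int k" using that by (simp add: nat_dvd_not_less)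
    ultimately show ?thesis using unit_root_eq_1_iff[of m] that by simp
  qed
  have \<xi>: "?\<xi> ^ (d * a) = unit_root 1 (int k)" and \<eta>: "?\<eta> ^ (d * b) = unit_root 1 (int l)"
    using unit_root_power[OF da_pos(1), of 1] unit_root_power[OF da_pos(2), of 1] by simp_all
  have "?\<xi> ^ (2 * (d * a)) = unit_root 1 (int k + int k)"
    unfolding unit_root_add \<xi>[symmetric] by (simp only: power_add[symmetric] mult_2)
  also have "\<dots> = 1" by (subst unit_root_eq_1_iff) simp_all
  finally have "?\<xi> ^ (2 * (d * a)) = 1" .
  moreover have "unit_root 1 (int k) = unit_root 1 (int l)"
    using kl(5) by (subst unit_root_eq_iff) simp_all
  ultimately show "p \<in> ?I" unfolding p using sq[OF kl(1,2)] sq[OF kl(3,4)] \<xi> \<eta>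
    by (intro CollectI exI[of _ ?\<xi>] exI[of _ ?\<eta>] exI[of _ z] conjI) simp_all
qed

lemma char_variety_Union:
  "char_variety (d * a) (d * b) = \<Union> (line ` line_index \<union> curve ` curve_index)"
  unfolding char_variety_explicit[OF da_pos] Union_curves Union_lines by (simp add: Un_commute)

lemma line_disjoint:
  assumes "v \<in> line_index" "w \<in> line_index" "v \<noteq> w"
  shows "line v \<inter> line w = {}"
proof -
  obtain k l k' l' where v: "v = (k, l)" "w = (k', l')" by (cases v, cases w)
  have eq: "r = s" if "0 < r" "r < m" "0 < s" "s < m"
      "joukowski (unit_root m (int r)) = joukowski (unit_root m (int s))" for m r s
  proof -
    have "2 * int m dvd int r - int s \<or> 2 * int m dvd int r + int s"
      using joukowski_unit_root_eq_iff[of m] that by simp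
    then show ?thesis
    proof
      assume "2 * int m dvd int r - int s"
      moreover have "\<bar>int r - int s\<bar> < 2 * int m" using that by linarith
      ultimately have "int r - int s = 0"
        using dvd_imp_le_int[of "int r - int s" "2 * int m"] by (cases "int r - int s = 0") simp_all
      then show ?thesis by simp
    next
      assume "2 * int m dvd int r + int s"
      then have "2 * int m \<le> int r + int s" using that by (intro zdvd_imp_le) auto
      then show ?thesis using that by linarith
    qed
  qed
  show ?thesis
    using assms eq[of k "d * a" k'] eq[of l "d * b" l']
    by (auto simp: v line_def line_index_def)
qed

lemma curve_disjoint:
  assumes "i \<in> curve_index" "j \<in> curve_index" "i \<noteq> j"
  shows "curve i \<inter> curve j = {}"
proof (rule ccontr)
  assume "curve i \<inter> curve j \<noteq> {}"
  then obtain p where p: "p \<in> curve i" "p \<in> curve j" by blast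
  from p(1) obtain \<xi> \<eta> where nz: "\<xi> \<noteq> 0" "\<eta> \<noteq> 0" "p = diag_char \<xi> \<eta>"
    unfolding curve_def by (elim CollectE exE conjE)
  have "joukowski (unit_root d (2 * int i)) = joukowski (unit_root d (2 * int j))"
    using p diag_char_in_curve_iff[OF nz(1,2), of i] diag_char_in_curve_iff[OF nz(1,2), of j] nz(3) by simp
  then have "2 * int d dvd 2 * int i - 2 * int j \<or> 2 * int d dvd 2 * int i + 2 * int j"
    using joukowski_unit_root_eq_iff[OF pos(1)] by blast
  then have "int d dvd int i - int j \<or> int d dvd int i + int j"
    by (simp only: right_diff_distrib[symmetric] distrib_left[symmetric] dvd_mult_cancel_left) simp
  then show False
  proof
    assume "int d dvd int i - int j"
    then have "int d \<le> \<bar>int i - int j\<bar>" using assms(3) dvd_imp_le_int[of "int i - int j" "int d"] by simp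
    then show False using assms pos by (auto simp: curve_index_def)
  next
    assume "int d dvd int i + int j"
    then have "int d \<le> int i + int j" using assms(3) by (intro zdvd_imp_le) auto
    then show False using assms pos by (auto simp: curve_index_def)
  qed
qed

text \<open>The line \<open>(k, l)\<close> contains exactly two reducible characters: the second eigenvalue may be taken
  with either exponent \<open>l\<close> or \<open>- l\<close> relative to the first. The two summands say whether these
  two points lie on the curve \<open>i\<close>, that is, whether \<open>(k - l) / 2\<close> and \<open>(k + l) / 2\<close> are
  congruent to \<open>i\<close> or \<open>- i\<close> modulo \<open>d\<close>.\<close>

definition incidence :: "nat \<times> nat \<Rightarrow> nat \<Rightarrow> nat" where
  "incidence = (\<lambda>(k, l) i.
    of_bool (2 * int d dvd int k - int l - 2 * int i \<or> 2 * int d dvd int k - int l + 2 * int i) +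
    of_bool (2 * int d dvd int k + int l - 2 * int i \<or> 2 * int d dvd int k + int l + 2 * int i))"

lemma line_Int_curve:
  assumes "v \<in> line_index"
  shows "finite (line v \<inter> curve i)" "card (line v \<inter> curve i) = incidence v i"
proof -
  obtain k l where v: "v = (k, l)" by (cases v)
  have kl: "0 < k" "k < d * a" "0 < l" "l < d * b" using assms by (auto simp: v line_index_def)
  define \<xi> \<eta> where "\<xi> = unit_root (d * a) (int k)" and "\<eta> = unit_root (d * b) (int l)"
  have nz: "\<xi> \<noteq> 0" "\<eta> \<noteq> 0" "inverse \<eta> \<noteq> 0" by (simp_all add: \<xi>_def \<eta>_def)
  define P Q where "P = diag_char \<xi> (inverse \<eta>)" and "Q = diag_char \<xi> \<eta>"
  have \<xi>a: "\<xi> ^ a = unit_root d (int k)" and \<eta>b: "\<eta> ^ b = unit_root d (int l)"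
    unfolding \<xi>_def \<eta>_def by (rule unit_root_power[OF pos(2)], rule unit_root_power[OF pos(3)])
  have Pin: "P \<in> curve i \<longleftrightarrow> 2 * int d dvd int k + int l - 2 * int i \<or> 2 * int d dvd int k + int l + 2 * int i"
    unfolding P_def diag_char_in_curve_iff[OF nz(1,3)] joukowski_unit_root_eq_iff[OF pos(1), symmetric]
    by (simp add: \<xi>a \<eta>b power_inverse unit_root_add)
  have Qin: "Q \<in> curve i \<longleftrightarrow> 2 * int d dvd int k - int l - 2 * int i \<or> 2 * int d dvd int k - int l + 2 * int i"
    unfolding Q_def diag_char_in_curve_iff[OF nz(1,2)] joukowski_unit_root_eq_iff[OF pos(1), symmetric]
    by (simp only: \<xi>a \<eta>b unit_root_minus[symmetric] unit_root_add[symmetric]) simp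
  \<comment> \<open>The two points differ because neither eigenvalue is its own inverse.\<close>
  have "P \<noteq> Q"
  proof
    assume "P = Q"
    then have "joukowski (\<xi> * inverse \<eta>) = joukowski (\<xi> * \<eta>)" by (simp add: P_def Q_def diag_char_def)
    then have "\<xi> * inverse \<eta> = \<xi> * \<eta> \<or> \<xi> * inverse \<eta> = inverse (\<xi> * \<eta>)"
      using joukowski_eq_iff[of "\<xi> * inverse \<eta>" "\<xi> * \<eta>"] nz by simp
    then have "joukowski \<eta> - 2 * \<eta> = 0 \<or> joukowski \<xi> - 2 * \<xi> = 0"
      using nz by (auto simp: joukowski_def)
    then have "\<eta> * \<eta> = 1 \<or> \<xi> * \<xi> = 1" using nz by (auto simp: joukowski_def field_simps)
    then have "2 * int (d * b) dvd int l + int l \<or> 2 * int (d * a) dvd int k + int k"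
      unfolding \<xi>_def \<eta>_def unit_root_add[symmetric]
      using unit_root_eq_1_iff[OF da_pos(1)] unit_root_eq_1_iff[OF da_pos(2)] by blast
    then have "2 * (d * b) dvd 2 * l \<or> 2 * (d * a) dvd 2 * k"
      by (metis int_dvd_int_iff mult_2 of_nat_add of_nat_mult of_nat_numeral)
    then show False using kl by (auto simp: nat_dvd_not_less)
  qed
  have "line v \<inter> curve i = {p \<in> {P, Q}. p \<in> curve i}"
  proof (intro equalityI subsetI)
    fix p assume p: "p \<in> line v \<inter> curve i"
    then obtain z where pz: "p = (joukowski \<xi>, joukowski \<eta>, z)" by (auto simp: line_def v \<xi>_def \<eta>_def)
    obtain \<xi>' \<eta>' where nz': "\<xi>' \<noteq> 0" "\<eta>' \<noteq> 0" and p': "p = diag_char \<xi>' \<eta>'"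
      using p unfolding curve_def by blast
    have "\<xi>' = \<xi> \<or> \<xi>' = inverse \<xi>" "\<eta>' = \<eta> \<or> \<eta>' = inverse \<eta>"
      using pz p' nz nz' joukowski_eq_iff by (auto simp: diag_char_def)
    then have "p = P \<or> p = Q"
      using p' diag_char_inverse[of \<xi> \<eta>] diag_char_inverse[of \<xi> "inverse \<eta>"]
      by (auto simp: P_def Q_def)
    then show "p \<in> {p \<in> {P, Q}. p \<in> curve i}" using p by blast
  qed (auto simp: line_def v P_def Q_def diag_char_def \<xi>_def \<eta>_def)
  then have *: "line v \<inter> curve i = (if P \<in> curve i then {P} else {}) \<union> (if Q \<in> curve i then {Q} else {})"
    by auto
  show "finite (line v \<inter> curve i)" unfolding * by simp
  show "card (line v \<inter> curve i) = incidence v i"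
    by (subst *) (use \<open>P \<noteq> Q\<close> Pin Qin in \<open>simp add: incidence_def v\<close>)
qed

lemma infinite_line: "infinite (line v)"
proof -
  obtain k l where v: "v = (k, l)" by (cases v)
  have "(\<lambda>p. snd (snd p)) ` line v = (UNIV :: complex set)" by (auto simp: v line_def image_iff)
  then have "infinite ((\<lambda>p. snd (snd p)) ` line v)" by (simp add: infinite_UNIV_char_0)
  then show ?thesis by (rule contrapos_nn) (rule finite_imageI)
qed

lemma infinite_curve: "infinite (curve i)"
proof -
  have "y \<in> (\<lambda>p. fst (snd p)) ` curve i" for y
  proof -
    obtain \<eta> where \<eta>: "\<eta> \<noteq> 0" "joukowski \<eta> = y" using joukowski_surj by blast
    define c where "c = unit_root d (2 * int i) * \<eta> ^ b"
    have c: "c \<noteq> 0" using \<eta> by (simp add: c_def)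
    have "exp (Ln c / of_nat a) ^ a = c"
      using pos(2) c by (simp add: exp_of_nat_mult[symmetric])
    then obtain \<xi> where \<xi>: "\<xi> ^ a = c" by blast
    have "\<xi> \<noteq> 0" using \<xi> c pos by (auto simp: power_0_left)
    then have "diag_char \<xi> \<eta> \<in> curve i" unfolding curve_def using \<xi> \<eta> c_def by blast
    then show ?thesis using \<eta> by (intro image_eqI[of _ _ "diag_char \<xi> \<eta>"]) (simp_all add: diag_char_def)
  qed
  then have "(\<lambda>p. fst (snd p)) ` curve i = (UNIV :: complex set)" by blast
  then have "infinite ((\<lambda>p. fst (snd p)) ` curve i)" by (simp add: infinite_UNIV_char_0)
  then show ?thesis by (rule contrapos_nn) (rule finite_imageI)
qed

definition component :: "(nat \<times> nat) + nat \<Rightarrow> (complex \<times> complex \<times> complex) set" where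
  "component = case_sum line curve"

definition component_index :: "((nat \<times> nat) + nat) set" where
  "component_index = Inl ` line_index \<union> Inr ` curve_index"

fun meet :: "(nat \<times> nat) + nat \<Rightarrow> (nat \<times> nat) + nat \<Rightarrow> nat" where
  "meet (Inl v) (Inr i) = incidence v i"
| "meet (Inr i) (Inl v) = incidence v i"
| "meet (Inl v) (Inl w) = 0"
| "meet (Inr i) (Inr j) = 0"

lemma component_index_iff [simp]:
  "Inl v \<in> component_index \<longleftrightarrow> v \<in> line_index" "Inr i \<in> component_index \<longleftrightarrow> i \<in> curve_index"
  by (auto simp: component_index_def)

lemma component_Int:
  assumes "u \<in> component_index" "v \<in> component_index" "u \<noteq> v"
  shows "finite (component u \<inter> component v)" "card (component u \<inter> component v) = meet u v"
  using assms
  by (cases u; cases v;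
      simp add: component_def line_disjoint curve_disjoint line_Int_curve Int_commute[of "curve _" "line _"])+

lemma infinite_component: "infinite (component u)"
  by (cases u) (simp_all add: component_def infinite_line infinite_curve)

lemma component_incomparable:
  assumes "u \<in> component_index" "v \<in> component_index" "component u \<subseteq> component v"
  shows "u = v"
proof (rule ccontr)
  assume "u \<noteq> v"
  then have "finite (component u \<inter> component v)" using component_Int assms by blast
  then show False using assms(3) infinite_component[of u] by (simp add: Int_absorb2)
qed

lemma inj_component: "inj_on component component_index"
  by (rule inj_onI) (simp add: component_incomparable)

lemma finite_line_index: "finite line_index"
  by (rule finite_subset[of _ "{..<d * a} \<times> {..<d * b}"]) (auto simp: line_index_def)

lemma finite_component_index: "finite component_index"
  by (simp add: component_index_def finite_line_index curve_index_def)

lemma irreducible_components_char_variety: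
  "irreducible_components (char_variety (d * a) (d * b)) = component ` component_index"
proof -
  have X: "char_variety (d * a) (d * b) = \<Union> (component ` component_index)"
    unfolding char_variety_Union component_index_def component_def by (simp add: image_Un image_image)
  have irr: "irreducible_algebraic_set (component u)" for u
    by (cases u) (simp_all add: component_def irreducible_line irreducible_curve)
  have "irreducible_components (\<Union> (component ` component_index)) = component ` component_index"
  proof (rule irreducible_components_Union)
    show "finite (component ` component_index)" by (simp add: finite_component_index)
    show "irreducible_algebraic_set V" if "V \<in> component ` component_index" for V
      using that by (elim imageE) (simp only: irr)
    show "V = W" if "V \<in> component ` component_index" "W \<in> component ` component_index" "V \<subseteq> W" for V W
      using that component_incomparable by blast
  qed
  then show ?thesis unfolding X .
qed

end

text \<open>From here on only the incidence numbers matter, and the question is about finite weighted graphs.\<close>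

lemma same_combinatorial_structure_iff:
  assumes "torus_data d a b" "torus_data d' a' b'"
  shows "same_combinatorial_structure (char_variety (d * a) (d * b)) (char_variety (d' * a') (d' * b'))
    \<longleftrightarrow> (\<exists>\<gamma>. bij_betw \<gamma> (torus_data.component_index d a b) (torus_data.component_index d' a' b') \<and>
      (\<forall>u\<in>torus_data.component_index d a b. \<forall>v\<in>torus_data.component_index d a b. u \<noteq> v \<longrightarrow>
        torus_data.meet d u v = torus_data.meet d' (\<gamma> u) (\<gamma> v)))"
proof -
  interpret X: torus_data d a b by fact
  interpret Y: torus_data d' a' b' by fact
  have bX: "bij_betw X.component X.component_index (X.component ` X.component_index)"
    by (rule inj_on_imp_bij_betw[OF X.inj_component])
  have bY: "bij_betw Y.component Y.component_index (Y.component ` Y.component_index)"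
    by (rule inj_on_imp_bij_betw[OF Y.inj_component])
  have eqpoll: "X.component u \<inter> X.component v \<approx> Y.component u' \<inter> Y.component v'
      \<longleftrightarrow> X.meet u v = Y.meet u' v'"
    if "u \<in> X.component_index" "v \<in> X.component_index" "u \<noteq> v"
      "u' \<in> Y.component_index" "v' \<in> Y.component_index" "u' \<noteq> v'" for u v u' v'
    using eqpoll_iff_card[OF X.component_Int(1)[OF that(1-3)] Y.component_Int(1)[OF that(4-6)]]
      X.component_Int(2)[OF that(1-3)] Y.component_Int(2)[OF that(4-6)] by simp
  show ?thesis
    unfolding same_combinatorial_structure_def X.irreducible_components_char_variety
      Y.irreducible_components_char_variety
  proof (intro iffI; elim exE conjE)
    fix \<beta> assume bij: "bij_betw \<beta> (X.component ` X.component_index) (Y.component ` Y.component_index)"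
      and \<beta>: "\<forall>A\<in>X.component ` X.component_index. \<forall>B\<in>X.component ` X.component_index.
        A \<noteq> B \<longrightarrow> A \<inter> B \<approx> \<beta> A \<inter> \<beta> B"
    define \<gamma> where "\<gamma> = inv_into Y.component_index Y.component \<circ> (\<beta> \<circ> X.component)"
    have bij\<gamma>: "bij_betw \<gamma> X.component_index Y.component_index"
      unfolding \<gamma>_def by (intro bij_betw_trans[OF bij_betw_trans[OF bX bij]] bij_betw_inv_into[OF bY])
    have \<gamma>: "Y.component (\<gamma> u) = \<beta> (X.component u)" if "u \<in> X.component_index" for u
      unfolding \<gamma>_def o_def using bij that by (intro f_inv_into_f) (auto simp: bij_betw_def)
    have "X.meet u v = Y.meet (\<gamma> u) (\<gamma> v)"
      if uv: "u \<in> X.component_index" "v \<in> X.component_index" "u \<noteq> v" for u v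
    proof -
      have \<gamma>uv: "\<gamma> u \<in> Y.component_index" "\<gamma> v \<in> Y.component_index" "\<gamma> u \<noteq> \<gamma> v"
        using bij\<gamma> uv by (auto simp: bij_betw_def inj_on_def)
      have "X.component u \<noteq> X.component v" using X.inj_component uv by (auto simp: inj_on_def)
      then have "X.component u \<inter> X.component v \<approx> \<beta> (X.component u) \<inter> \<beta> (X.component v)"
        using \<beta> uv by blast
      then show ?thesis using eqpoll[OF uv \<gamma>uv] \<gamma> uv by simp
    qed
    then show "\<exists>\<gamma>. bij_betw \<gamma> X.component_index Y.component_index \<and>
      (\<forall>u\<in>X.component_index. \<forall>v\<in>X.component_index. u \<noteq> v \<longrightarrow> X.meet u v = Y.meet (\<gamma> u) (\<gamma> v))"
      using bij\<gamma> by blast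
  next
    fix \<gamma> assume bij: "bij_betw \<gamma> X.component_index Y.component_index"
      and \<gamma>: "\<forall>u\<in>X.component_index. \<forall>v\<in>X.component_index. u \<noteq> v \<longrightarrow> X.meet u v = Y.meet (\<gamma> u) (\<gamma> v)"
    define \<beta> where "\<beta> = Y.component \<circ> (\<gamma> \<circ> inv_into X.component_index X.component)"
    have bij\<beta>: "bij_betw \<beta> (X.component ` X.component_index) (Y.component ` Y.component_index)"
      unfolding \<beta>_def by (intro bij_betw_trans[OF bij_betw_trans[OF bij_betw_inv_into[OF bX] bij] bY])
    have \<beta>: "\<beta> (X.component u) = Y.component (\<gamma> u)" if "u \<in> X.component_index" for u
      using X.inj_component that by (simp add: \<beta>_def)
    have "X.component u \<inter> X.component v \<approx> \<beta> (X.component u) \<inter> \<beta> (X.component v)"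
      if uv: "u \<in> X.component_index" "v \<in> X.component_index" "X.component u \<noteq> X.component v" for u v
    proof -
      have ne: "u \<noteq> v" using uv(3) by blast
      have \<gamma>uv: "\<gamma> u \<in> Y.component_index" "\<gamma> v \<in> Y.component_index" "\<gamma> u \<noteq> \<gamma> v"
        using bij uv ne by (auto simp: bij_betw_def inj_on_def)
      show ?thesis using eqpoll[OF uv(1,2) ne \<gamma>uv] \<gamma> uv ne \<beta> by simp
    qed
    then show "\<exists>\<beta>. bij_betw \<beta> (X.component ` X.component_index) (Y.component ` Y.component_index) \<and>
      (\<forall>A\<in>X.component ` X.component_index. \<forall>B\<in>X.component ` X.component_index.
        A \<noteq> B \<longrightarrow> A \<inter> B \<approx> \<beta> A \<inter> \<beta> B)"
      using bij\<beta> by blast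
  qed
qed

section \<open>Counting in the incidence graph\<close>

lemma card_residue_interval:
  fixes M :: int
  assumes "M > 0"
  shows "card {k \<in> {lo..<lo + M * int q}. M dvd k - c} = q"
proof (induction q)
  case 0
  then show ?case by simp
next
  case (Suc q)
  define s where "s = lo + M * int q"
  define k0 where "k0 = s + (c - s) mod M"
  have block: "{k \<in> {s..<s + M}. M dvd k - c} = {k0}"
  proof (intro equalityI subsetI)
    fix k assume "k \<in> {k \<in> {s..<s + M}. M dvd k - c}"
    then have k: "0 \<le> k - s" "k - s < M" "M dvd k - c" by auto
    have "(c - s) mod M = (k - s) mod M"
      using k(3) by (simp add: mod_eq_dvd_iff dvd_diff_commute)
    then show "k \<in> {k0}" using k(1,2) by (simp add: k0_def)
  next
    fix k assume k: "k \<in> {k0}"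
    have "M dvd (c - s) mod M - (c - s)" by (simp add: mod_eq_dvd_iff[symmetric])
    moreover have "(c - s) mod M - (c - s) = k0 - c" by (simp add: k0_def)
    ultimately have "M dvd k0 - c" by metis
    then show "k \<in> {k \<in> {s..<s + M}. M dvd k - c}"
      using k assms by (simp add: k0_def)
  qed
  have split: "{k \<in> {lo..<lo + M * int (Suc q)}. M dvd k - c}
      = {k \<in> {lo..<lo + M * int q}. M dvd k - c} \<union> {k \<in> {s..<s + M}. M dvd k - c}"
  proof -
    have eq: "lo + M * int (Suc q) = s + M" "lo + M * int q = s" by (simp_all add: s_def algebra_simps)
    have "lo \<le> s" using assms by (simp add: s_def)
    then show ?thesis unfolding eq using assms by auto
  qed
  have "card ({k \<in> {lo..<lo + M * int q}. M dvd k - c} \<union> {k \<in> {s..<s + M}. M dvd k - c}) = q + 1"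
  proof -
    have "finite {k \<in> {lo..<lo + M * int q}. M dvd k - c}" by (rule finite_subset[OF Collect_restrict]) simp
    moreover have "s \<le> k0" using assms by (simp add: k0_def)
    then have "k0 \<notin> {k \<in> {lo..<lo + M * int q}. M dvd k - c}" by (simp add: s_def)
    ultimately show ?thesis unfolding block using Suc by simp
  qed
  then show ?case unfolding split by simp
qed

lemma sum_symmetric_interval:
  fixes h :: "int \<Rightarrow> int"
  assumes "m \<ge> 1"
  shows "(\<Sum>k\<in>{- int m..<int m}. h k) = h 0 + h (- int m) + (\<Sum>k\<in>{1..<m}. h (int k) + h (- int k))"
  using assms
proof (induction m rule: dec_induct)
  case base
  have "{- 1..<1 :: int} = {-1, 0}" by auto
  then show ?case by simp
next
  case (step m)
  have "{- int (Suc m)..<int (Suc m)} = insert (- int (Suc m)) (insert (int m) {- int m..<int m})"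
    by auto
  moreover have "- int (Suc m) \<notin> insert (int m) {- int m..<int m}" "int m \<notin> {- int m..<int m}" by auto
  ultimately show ?case using step by simp
qed

lemma card_even_odd_interval:
  "card {k \<in> {n<..<n + (2 * j + 1)}. even k} = j" "card {k \<in> {n<..<n + (2 * j + 1)}. odd k} = j" for n j :: nat
proof (induction j)
  case (Suc j)
  have split: "{k \<in> {n<..<n + (2 * Suc j + 1)}. P k}
      = {k \<in> {n<..<n + (2 * j + 1)}. P k} \<union> {k \<in> {n + (2 * j + 1), n + (2 * j + 2)}. P k}" for P
    by auto
  have two: "card {k \<in> {n + (2 * j + 1), n + (2 * j + 2)}. P k} = 1" if "P = even \<or> P = odd" for P
  proof (cases "P (n + (2 * j + 1))")
    case True
    then have "{k \<in> {n + (2 * j + 1), n + (2 * j + 2)}. P k} = {n + (2 * j + 1)}" using that by auto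
    then show ?thesis by simp
  next
    case False
    then have "{k \<in> {n + (2 * j + 1), n + (2 * j + 2)}. P k} = {n + (2 * j + 2)}" using that by auto
    then show ?thesis by simp
  qed
  have "card {k \<in> {n<..<n + (2 * Suc j + 1)}. P k} = card {k \<in> {n<..<n + (2 * j + 1)}. P k} + 1"
    if "P = even \<or> P = odd" for P
  proof -
    have "card ({k \<in> {n<..<n + (2 * j + 1)}. P k} \<union> {k \<in> {n + (2 * j + 1), n + (2 * j + 2)}. P k})
        = card {k \<in> {n<..<n + (2 * j + 1)}. P k} + card {k \<in> {n + (2 * j + 1), n + (2 * j + 2)}. P k}"
      by (rule card_Un_disjoint) auto
    then show ?thesis unfolding split two[OF that] .
  qed
  then show "card {k \<in> {n<..<n + (2 * Suc j + 1)}. even k} = Suc j"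
    "card {k \<in> {n<..<n + (2 * Suc j + 1)}. odd k} = Suc j" using Suc by simp_all
next
  case 0
  have "{n<..<n + (2 * 0 + 1)} = {}" by auto
  then show "card {k \<in> {n<..<n + (2 * 0 + 1)}. even k} = 0" "card {k \<in> {n<..<n + (2 * 0 + 1)}. odd k} = 0"
    by simp_all
qed

lemma card_block_parity:
  assumes "d \<ge> 1"
  shows "card {k \<in> {d * q<..<d * q + d}. even k} = (d - 1) div 2"
    and "card {k \<in> {d * q<..<d * q + d}. odd k} = d div 2"
proof -
  have "card {k \<in> {d * q<..<d * q + d}. even k} = (d - 1) div 2 \<and> card {k \<in> {d * q<..<d * q + d}. odd k} = d div 2"
  proof (cases "even d")
    case False
    then obtain j where "d = 2 * j + 1" by (elim oddE)
    then show ?thesis using card_even_odd_interval[of "d * q" j] by simp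
  next
    case True
    then obtain i where "d = 2 * i" by (elim evenE)
    then obtain j where d: "d = 2 * Suc j" using assms by (cases i) auto
    have n: "even (d * q)" using True by simp
    define N where "N = d * q"
    have last: "odd (N + (2 * j + 1))" using n by (simp add: N_def)
    have "{N<..<N + d} = insert (N + (2 * j + 1)) {N<..<N + (2 * j + 1)}" by (auto simp: d)
    then have "{k \<in> {N<..<N + d}. even k} = {k \<in> {N<..<N + (2 * j + 1)}. even k}"
      "{k \<in> {N<..<N + d}. odd k} = insert (N + (2 * j + 1)) {k \<in> {N<..<N + (2 * j + 1)}. odd k}"
      using last by auto
    then show ?thesis unfolding N_def[symmetric] using card_even_odd_interval[of N j] d by simp
  qed
  then show "card {k \<in> {d * q<..<d * q + d}. even k} = (d - 1) div 2"
    "card {k \<in> {d * q<..<d * q + d}. odd k} = d div 2" by blast+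
qed

text \<open>Each of the \<open>q\<close> gaps between consecutive multiples of \<open>d\<close> contributes the same numbers, whatever
  the parity of its end points.\<close>

lemma card_nonmultiples_parity:
  assumes "d \<ge> 1"
  shows "card {k \<in> {..<d * q}. \<not> d dvd k \<and> even k} = q * ((d - 1) div 2)"
    and "card {k \<in> {..<d * q}. \<not> d dvd k \<and> odd k} = q * (d div 2)"
proof -
  have split: "{k \<in> {..<d * Suc q}. \<not> d dvd k \<and> P k}
      = {k \<in> {..<d * q}. \<not> d dvd k \<and> P k} \<union> {k \<in> {d * q<..<d * q + d}. P k}" for q P
  proof (intro equalityI subsetI)
    fix k assume "k \<in> {k \<in> {..<d * Suc q}. \<not> d dvd k \<and> P k}"
    then have k: "k < d * q + d" "\<not> d dvd k" "P k" by simp_all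
    have "k \<noteq> d * q" using k(2) by (metis dvd_triv_left)
    then have "k < d * q \<or> d * q < k" by linarith
    then show "k \<in> {k \<in> {..<d * q}. \<not> d dvd k \<and> P k} \<union> {k \<in> {d * q<..<d * q + d}. P k}"
      using k by (elim disjE) simp_all
  next
    fix k assume k: "k \<in> {k \<in> {..<d * q}. \<not> d dvd k \<and> P k} \<union> {k \<in> {d * q<..<d * q + d}. P k}"
    have "\<not> d dvd k" if "d * q < k" "k < d * q + d"
    proof
      assume "d dvd k"
      then have "d dvd k - d * q" by (intro dvd_diff_nat) simp_all
      then show False using that nat_dvd_not_less[of "k - d * q" d] by linarith
    qed
    moreover have "k < d * q \<and> \<not> d dvd k \<and> P k \<or> d * q < k \<and> k < d * q + d \<and> P k" using k by simp
    ultimately show "k \<in> {k \<in> {..<d * Suc q}. \<not> d dvd k \<and> P k}" by (elim disjE) simp_all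
  qed
  have step: "card {k \<in> {..<d * Suc q}. \<not> d dvd k \<and> P k}
      = card {k \<in> {..<d * q}. \<not> d dvd k \<and> P k} + card {k \<in> {d * q<..<d * q + d}. P k}" for q P
    unfolding split by (subst card_Un_disjoint) auto
  show "card {k \<in> {..<d * q}. \<not> d dvd k \<and> even k} = q * ((d - 1) div 2)"
  proof (induction q)
    case (Suc q)
    show ?case unfolding step card_block_parity[OF assms] Suc by simp
  qed simp
  show "card {k \<in> {..<d * q}. \<not> d dvd k \<and> odd k} = q * (d div 2)"
  proof (induction q)
    case (Suc q)
    show ?case unfolding step card_block_parity[OF assms] Suc by simp
  qed simp
qed

text \<open>Used with \<open>A\<close> and \<open>B\<close> the congruences to \<open>i\<close> and to \<open>- i\<close>, and \<open>D\<close> the condition that these two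
  classes coincide.\<close>

lemma of_bool_disj_count:
  assumes "D \<longrightarrow> A = B" "A \<and> B \<longrightarrow> D"
  shows "(if D then 2 else 1) * (of_bool (A \<or> B) :: int) = of_bool A + of_bool B"
proof (cases D)
  case True
  then show ?thesis using assms(1) by (cases B) simp_all
next
  case False
  then show ?thesis using assms(2) by (cases A; cases B) simp_all
qed

context torus_data
begin

definition degree :: "(nat \<times> nat) + nat \<Rightarrow> nat" where
  "degree u = (\<Sum>v\<in>component_index - {u}. meet u v)"

text \<open>The lines whose two reducible points lie on different curves: viewed as edges between the
  curves, these are the edges that are not loops.\<close>

definition simple_lines :: "(nat \<times> nat) set" where
  "simple_lines = {(k, l) \<in> line_index. \<not> d dvd k \<and> \<not> d dvd l}"

text \<open>Half of the number of intersection points on a curve whose root of unity is not real.\<close>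

definition half_degree :: int where
  "half_degree = int (d * a * b) - int a - int b"

lemma card_component_index: "card component_index = card line_index + (d div 2 + 1)"
  unfolding component_index_def
  by (subst card_Un_disjoint) (auto simp: finite_line_index curve_index_def card_image)

lemma sum_component_index:
  "(\<Sum>v\<in>component_index - {u}. f (meet u v)) = (\<Sum>v\<in>component_index. f (meet u v))" if "f 0 = (0 :: nat)"
proof -
  have "meet u u = 0" by (cases u) simp_all
  then show ?thesis
    using that sum.remove[OF finite_component_index, of u "\<lambda>v. f (meet u v)"]
    by (cases "u \<in> component_index") simp_all
qed

lemma sum_component_index_split:
  "(\<Sum>v\<in>component_index. h v) = (\<Sum>v\<in>line_index. h (Inl v)) + (\<Sum>i\<in>curve_index. h (Inr i))"
  for h :: "(nat \<times> nat) + nat \<Rightarrow> nat"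
  unfolding component_index_def
  by (subst sum.union_disjoint) (auto simp: finite_line_index curve_index_def sum.reindex)

lemma sum_meet_pairs:
  fixes f :: "nat \<Rightarrow> nat"
  assumes "f 0 = 0"
  shows "(\<Sum>u\<in>component_index. \<Sum>v\<in>component_index - {u}. f (meet u v))
    = 2 * (\<Sum>v\<in>line_index. \<Sum>i\<in>curve_index. f (incidence v i))"
  unfolding sum_component_index[where f = f, OF assms] unfolding sum_component_index_split
  using sum.swap[of "\<lambda>i v. f (incidence v i)" line_index curve_index] by (simp add: assms)

text \<open>Every residue class modulo \<open>d\<close> has exactly one representative in \<open>0, \<dots>, d div 2\<close> up to sign; so
  each reducible point of a line lies on exactly one curve.\<close>

lemma line_curve_unique:
  assumes "even e"
  shows "\<exists>i\<in>curve_index. \<forall>j\<in>curve_index.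
    (2 * int d dvd e - 2 * int j \<or> 2 * int d dvd e + 2 * int j) \<longleftrightarrow> j = i"
proof -
  obtain q where e: "e = 2 * q" using assms by blast
  have dvd: "(2 * int d dvd e - 2 * int j \<or> 2 * int d dvd e + 2 * int j)
      \<longleftrightarrow> (int d dvd q - int j \<or> int d dvd q + int j)" for j
    unfolding e by (simp only: right_diff_distrib[symmetric] distrib_left[symmetric] dvd_mult_cancel_left) simp
  define r where "r = nat (q mod int d)"
  have r: "r < d" "int d dvd q - int r"
    using pos(1) by (auto simp: r_def nat_less_iff mod_eq_dvd_iff[symmetric])
  define i where "i = (if r \<le> d div 2 then r else d - r)"
  have i: "i \<in> curve_index" using r(1) by (auto simp: i_def curve_index_def)
  have "int d dvd q - int i \<or> int d dvd q + int i"
  proof (cases "r \<le> d div 2")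
    case False
    then have "q + int i = (q - int r) + int d" using r(1) by (simp add: i_def of_nat_diff)
    moreover have "int d dvd (q - int r) + int d" using r(2) by simp
    ultimately show ?thesis by metis
  qed (simp add: i_def r)
  moreover have "j = i" if "j \<in> curve_index" "int d dvd q - int j \<or> int d dvd q + int j" for j
  proof (rule ccontr)
    assume "j \<noteq> i"
    have "int d dvd int j - int i \<or> int d dvd int j + int i"
    proof -
      have "int j - int i = (q - int i) - (q - int j)" "int j - int i = (q + int j) - (q + int i)"
        "int j + int i = (q + int i) - (q - int j)" "int j + int i = (q + int j) - (q - int i)" by simp_all
      then show ?thesis using calculation that(2) dvd_diff by metis
    qed
    then show False
    proof
      assume "int d dvd int j - int i"
      then have "int d \<le> \<bar>int j - int i\<bar>" using \<open>j \<noteq> i\<close> dvd_imp_le_int[of "int j - int i" "int d"] by simp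
      then show False using i that pos by (auto simp: curve_index_def)
    next
      assume "int d dvd int j + int i"
      then have "int d \<le> int j + int i" using \<open>j \<noteq> i\<close> by (intro zdvd_imp_le) auto
      then show False using i that \<open>j \<noteq> i\<close> by (auto simp: curve_index_def)
    qed
  qed
  ultimately show ?thesis unfolding dvd using i by blast
qed

lemma finite_curve_index: "finite curve_index"
  by (simp add: curve_index_def)

lemma incidence_cases:
  assumes "v \<in> line_index"
  obtains i j where "i \<in> curve_index" "j \<in> curve_index"
    "\<And>c. c \<in> curve_index \<Longrightarrow> incidence v c = of_bool (c = i) + of_bool (c = j)"
    "i = j \<longleftrightarrow> v \<notin> simple_lines"
proof -
  obtain k l where v: "v = (k, l)" by (cases v)
  have "even (int k - int l)" "even (int k + int l)" using assms by (auto simp: v line_index_def)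
  then obtain i j where i: "i \<in> curve_index" "\<And>c. c \<in> curve_index \<Longrightarrow>
        (2 * int d dvd int k - int l - 2 * int c \<or> 2 * int d dvd int k - int l + 2 * int c) \<longleftrightarrow> c = i"
    and j: "j \<in> curve_index" "\<And>c. c \<in> curve_index \<Longrightarrow>
        (2 * int d dvd int k + int l - 2 * int c \<or> 2 * int d dvd int k + int l + 2 * int c) \<longleftrightarrow> c = j"
    using line_curve_unique[of "int k - int l"] line_curve_unique[of "int k + int l"] by metis
  \<comment> \<open>Up to sign, \<open>(k - l) / 2\<close> and \<open>(k + l) / 2\<close> agree modulo \<open>d\<close> when their difference \<open>l\<close> or their sum \<open>k\<close> does.\<close>
  have "i = j \<longleftrightarrow> d dvd k \<or> d dvd l"
  proof -
    have i': "2 * int d dvd int k - int l - 2 * int i \<or> 2 * int d dvd int k - int l + 2 * int i"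
      using i(2)[OF i(1)] by simp
    have kl: "d dvd k \<longleftrightarrow> 2 * int d dvd 2 * int k" "d dvd l \<longleftrightarrow> 2 * int d dvd 2 * int l" by simp_all
    have "i = j \<longleftrightarrow> 2 * int d dvd int k + int l - 2 * int i \<or> 2 * int d dvd int k + int l + 2 * int i"
      using j(2)[OF i(1)] by simp
    also have "\<dots> \<longleftrightarrow> 2 * int d dvd 2 * int k \<or> 2 * int d dvd 2 * int l"
    proof
      have "2 * int k = (int k + int l - 2 * int i) + (int k - int l + 2 * int i)"
        "2 * int k = (int k + int l + 2 * int i) + (int k - int l - 2 * int i)"
        "2 * int l = (int k + int l - 2 * int i) - (int k - int l - 2 * int i)"
        "2 * int l = (int k + int l + 2 * int i) - (int k - int l + 2 * int i)" by simp_all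
      moreover assume "2 * int d dvd int k + int l - 2 * int i \<or> 2 * int d dvd int k + int l + 2 * int i"
      ultimately show "2 * int d dvd 2 * int k \<or> 2 * int d dvd 2 * int l"
        using i' dvd_add dvd_diff by metis
    next
      have "int k + int l - 2 * int i = 2 * int k - (int k - int l + 2 * int i)"
        "int k + int l + 2 * int i = 2 * int k - (int k - int l - 2 * int i)"
        "int k + int l - 2 * int i = 2 * int l + (int k - int l - 2 * int i)"
        "int k + int l + 2 * int i = 2 * int l + (int k - int l + 2 * int i)" by simp_all
      moreover assume "2 * int d dvd 2 * int k \<or> 2 * int d dvd 2 * int l"
      ultimately show "2 * int d dvd int k + int l - 2 * int i \<or> 2 * int d dvd int k + int l + 2 * int i"
        using i' dvd_add dvd_diff by metis
    qed
    finally show ?thesis unfolding kl .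
  qed
  then have "i = j \<longleftrightarrow> v \<notin> simple_lines" using assms by (auto simp: v simple_lines_def)
  moreover have "incidence v c = of_bool (c = i) + of_bool (c = j)" if "c \<in> curve_index" for c
    unfolding incidence_def v prod.case i(2)[OF that] j(2)[OF that] ..
  ultimately show ?thesis using that i(1) j(1) by blast
qed

lemma sum_of_bool_eq:
  "i \<in> curve_index \<Longrightarrow> (\<Sum>c\<in>curve_index. of_bool (c = i)) = (1 :: nat)"
  by (simp add: of_bool_def finite_curve_index)

lemma sum_incidence:
  assumes "v \<in> line_index"
  shows "(\<Sum>c\<in>curve_index. incidence v c) = 2"
proof -
  obtain i j where "i \<in> curve_index" "j \<in> curve_index"
    "\<And>c. c \<in> curve_index \<Longrightarrow> incidence v c = of_bool (c = i) + of_bool (c = j)"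
    using incidence_cases[OF assms] by metis
  then show ?thesis by (simp add: sum.distrib sum_of_bool_eq)
qed

lemma sum_simple_incidence:
  assumes "v \<in> line_index"
  shows "(\<Sum>c\<in>curve_index. of_bool (incidence v c = 1)) = (if v \<in> simple_lines then 2 else 0 :: nat)"
proof -
  obtain i j where ij: "i \<in> curve_index" "j \<in> curve_index"
    "\<And>c. c \<in> curve_index \<Longrightarrow> incidence v c = of_bool (c = i) + of_bool (c = j)"
    "i = j \<longleftrightarrow> v \<notin> simple_lines"
    using incidence_cases[OF assms] by metis
  show ?thesis
  proof (cases "i = j")
    case True
    then have "(\<Sum>c\<in>curve_index. of_bool (incidence v c = 1)) = (\<Sum>c\<in>curve_index. 0 :: nat)"
      using ij(3) by (intro sum.cong) auto
    then show ?thesis using ij(4) True by simp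
  next
    case False
    then have "(\<Sum>c\<in>curve_index. of_bool (incidence v c = 1))
        = (\<Sum>c\<in>curve_index. of_bool (c = i) + of_bool (c = j) :: nat)"
      using ij(3) by (intro sum.cong) auto
    then show ?thesis using ij(1,2,4) False by (simp add: sum.distrib sum_of_bool_eq)
  qed
qed

lemma sum_degree: "(\<Sum>u\<in>component_index. degree u) = 4 * card line_index"
  unfolding degree_def using sum_meet_pairs[of "\<lambda>x. x"] by (simp add: sum_incidence)

lemma sum_simple_meet:
  "(\<Sum>u\<in>component_index. \<Sum>v\<in>component_index - {u}. of_bool (meet u v = 1)) = 4 * card simple_lines"
proof -
  have "simple_lines \<subseteq> line_index" by (auto simp: simple_lines_def)
  then have "(\<Sum>v\<in>line_index. if v \<in> simple_lines then 2 else 0 :: nat) = 2 * card simple_lines"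
    using finite_line_index by (simp add: sum.If_cases Int_absorb1)
  moreover have "(\<Sum>v\<in>line_index. \<Sum>i\<in>curve_index. of_bool (incidence v i = 1))
      = (\<Sum>v\<in>line_index. if v \<in> simple_lines then 2 else 0 :: nat)"
    by (rule sum.cong) (simp_all only: sum_simple_incidence)
  ultimately show ?thesis
    using sum_meet_pairs[of "\<lambda>x. of_bool (x = 1)"] by simp
qed

text \<open>Every gap between consecutive multiples of \<open>d\<close> contains \<open>(d - 1) div 2\<close> even and \<open>d div 2\<close> odd
  numbers, so the count is proportional to the number \<open>a b\<close> of pairs of gaps.\<close>

lemma card_simple_lines: "card simple_lines = a * b * (((d - 1) div 2)\<^sup>2 + (d div 2)\<^sup>2)"
proof -
  let ?S = "\<lambda>q P. {k \<in> {..<d * q}. \<not> d dvd k \<and> P k}"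
  have "simple_lines = ?S a even \<times> ?S b even \<union> ?S a odd \<times> ?S b odd"
    unfolding simple_lines_def line_index_def
    by (auto intro: Nat.gr0I)
  moreover have "card (?S a even \<times> ?S b even \<union> ?S a odd \<times> ?S b odd)
      = card (?S a even) * card (?S b even) + card (?S a odd) * card (?S b odd)"
    by (subst card_Un_disjoint) (auto simp: card_cartesian_product)
  ultimately show ?thesis
    unfolding card_nonmultiples_parity[OF pos(1)] by (simp add: power2_eq_square algebra_simps)
qed

lemma degree_line: "v \<in> line_index \<Longrightarrow> degree (Inl v) = 2"
  unfolding degree_def using sum_component_index[of "\<lambda>x. x" "Inl v"]
  by (simp add: sum_component_index_split sum_incidence)

lemma degree_curve_sum: "degree (Inr i) = (\<Sum>v\<in>line_index. incidence v i)"
  unfolding degree_def using sum_component_index[of "\<lambda>x. x" "Inr i"]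
  by (simp add: sum_component_index_split)

text \<open>Allowing both signs for \<open>k\<close> and \<open>l\<close> makes the count almost one over full periods: for fixed \<open>l\<close>
  exactly \<open>a\<close> of the \<open>2 d a\<close> values of \<open>k\<close> lie in a given class modulo \<open>2 d\<close>. Removing the
  forbidden values \<open>0\<close> and \<open>- d a\<close> of \<open>k\<close>, and \<open>0\<close> and \<open>- d b\<close> of \<open>l\<close>, costs \<open>2 b\<close> and \<open>2 a\<close>
  solutions; the four corners, removed twice, are added back. Since \<open>a\<close> and \<open>b\<close> are not both even,
  exactly two corners are solutions when \<open>d\<close> divides \<open>r\<close>.\<close>

lemma signed_incidence_count:
  fixes r :: int
  defines "g \<equiv> \<lambda>k l :: int. of_bool (2 * int d dvd k - l - r) :: int"
  shows "(\<Sum>k\<in>{1..<d * a}. \<Sum>l\<in>{1..<d * b}.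
      g (int k) (int l) + g (int k) (- int l) + (g (- int k) (int l) + g (- int k) (- int l)))
    = 2 * half_degree + (if int d dvd r then 2 else 0)"
proof -
  let ?m = "d * a" and ?n = "d * b"
  let ?K = "{- int ?m..<int ?m}" and ?L = "{- int ?n..<int ?n}"
  have d2: "2 * int d > 0" using pos by simp
  have row: "(\<Sum>k\<in>?K. g k l) = int a" for l
  proof -
    have "(\<Sum>k\<in>?K. g k l) = int (card {k \<in> ?K. 2 * int d dvd k - (l + r)})"
      by (simp add: g_def of_bool_def sum.If_cases diff_diff_eq Int_def)
    moreover have "?K = {- int ?m..<- int ?m + 2 * int d * int a}" by (simp add: algebra_simps)
    ultimately show ?thesis by (simp only: card_residue_interval[OF d2])
  qed
  have col: "(\<Sum>l\<in>?L. g k l) = int b" for k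
  proof -
    have "(\<Sum>l\<in>?L. g k l) = (\<Sum>l\<in>?L. of_bool (2 * int d dvd l - (k - r)))"
    proof (rule sum.cong)
      fix l
      have "k - l - r = - (l - (k - r))" by simp
      then show "g k l = of_bool (2 * int d dvd l - (k - r))" unfolding g_def by (simp only: dvd_minus_iff)
    qed simp
    also have "\<dots> = int (card {l \<in> ?L. 2 * int d dvd l - (k - r)})"
      by (simp add: of_bool_def sum.If_cases Int_def)
    finally have "(\<Sum>l\<in>?L. g k l) = int (card {l \<in> ?L. 2 * int d dvd l - (k - r)})" .
    moreover have "?L = {- int ?n..<- int ?n + 2 * int d * int b}" by (simp add: algebra_simps)
    ultimately show ?thesis by (simp only: card_residue_interval[OF d2])
  qed
  define H where "H k = (\<Sum>l\<in>{1..<?n}. g k (int l) + g k (- int l))" for k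
  have H: "H k = int b - g k 0 - g k (- int ?n)" for k
    using sum_symmetric_interval[OF da_pos(2), of "g k"] col[of k] by (simp add: H_def)
  have "(\<Sum>k\<in>?K. H k) = int (2 * ?m) * int b - int a - int a"
    unfolding H sum_subtractf row by simp
  moreover have "(\<Sum>k\<in>?K. H k) = H 0 + H (- int ?m) + (\<Sum>k\<in>{1..<?m}. H (int k) + H (- int k))"
    by (rule sum_symmetric_interval[OF da_pos(1)])
  ultimately have main: "(\<Sum>k\<in>{1..<?m}. H (int k) + H (- int k))
      = 2 * half_degree + (g 0 0 + g 0 (- int ?n) + g (- int ?m) 0 + g (- int ?m) (- int ?n))"
    unfolding H by (simp add: half_degree_def algebra_simps)
  \<comment> \<open>Dividing by \<open>d\<close>, the corners satisfy the congruence when \<open>s\<close>, \<open>b - s\<close>, \<open>- a - s\<close> and \<open>b - a - s\<close> are even.\<close>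
  have corners: "g 0 0 + g 0 (- int ?n) + g (- int ?m) 0 + g (- int ?m) (- int ?n) = (if int d dvd r then 2 else 0)"
  proof (cases "int d dvd r")
    case False
    have "\<not> 2 * int d dvd k - l - r" if "int d dvd k" "int d dvd l" for k l
      using that False by (metis dvd_diff_right_iff dvd_mult_left dvd_trans dvd_triv_right dvd_diff)
    then have "g k l = 0" if "int d dvd k" "int d dvd l" for k l
      using that by (simp add: g_def)
    then show ?thesis using False by simp
  next
    case True
    then obtain s where r: "r = int d * s" by blast
    have even: "2 * int d dvd int d * k \<longleftrightarrow> even k" for k
      using pos(1) by (simp add: mult.commute[of 2])
    have "g 0 0 = of_bool (even s)" "g 0 (- int ?n) = of_bool (even (int b - s))"
      "g (- int ?m) 0 = of_bool (even (- int a - s))"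
      "g (- int ?m) (- int ?n) = of_bool (even (int b - int a - s))"
      unfolding g_def r even[symmetric] by (simp_all add: algebra_simps)
    moreover have "\<not> (even a \<and> even b)" using coprime_common_divisor_nat[OF coprime, of 2] by auto
    ultimately show ?thesis using True by auto
  qed
  show ?thesis
    unfolding main[unfolded corners, symmetric] H_def by (simp add: sum.distrib)
qed

text \<open>The four sign choices of \<open>k\<close> and \<open>l\<close> correspond to the two reducible points and the two
  residues \<open>i\<close> and \<open>- i\<close>; if these residues coincide, each incidence is counted twice.\<close>

lemma degree_curve:
  "(if d dvd 2 * i then 2 else 1) * int (degree (Inr i)) = 2 * half_degree + (if d dvd 2 * i then 2 else 0)"
proof -
  define g where "g k l = (of_bool (2 * int d dvd k - l - 2 * int i) :: int)" for k l :: int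
  define G where "G k l = g (int k) (int l) + g (int k) (- int l) + (g (- int k) (int l) + g (- int k) (- int l))"
    for k l :: nat
  have neg: "g (- k) l = of_bool (2 * int d dvd k + l + 2 * int i)" for k l
  proof -
    have "- k - l - 2 * int i = - (k + l + 2 * int i)" by simp
    then show ?thesis unfolding g_def by (simp only: dvd_minus_iff)
  qed
  have count: "(if d dvd 2 * i then 2 else 1) * int (incidence (k, l) i) = G k l" for k l
  proof -
    have *: "(if d dvd 2 * i then 2 else 1) * (of_bool (2 * int d dvd e - 2 * int i \<or> 2 * int d dvd e + 2 * int i) :: int)
        = of_bool (2 * int d dvd e - 2 * int i) + of_bool (2 * int d dvd e + 2 * int i)" for e
    proof -
      have "(e + 2 * int i) - (e - 2 * int i) = 2 * int (2 * i)" by simp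
      then have "2 * int d dvd (e + 2 * int i) - (e - 2 * int i) \<longleftrightarrow> d dvd 2 * i"
        by (simp only: dvd_mult_cancel_left int_dvd_int_iff) simp
      moreover have "2 * int d dvd y" if "2 * int d dvd x" "2 * int d dvd y - x" for x y
        using dvd_add[OF that] by simp
      moreover have "2 * int d dvd x" if "2 * int d dvd y" "2 * int d dvd y - x" for x y
        using dvd_diff[OF that] by simp
      ultimately have "d dvd 2 * i \<longrightarrow> (2 * int d dvd e - 2 * int i) = (2 * int d dvd e + 2 * int i)"
        "2 * int d dvd e - 2 * int i \<and> 2 * int d dvd e + 2 * int i \<longrightarrow> d dvd 2 * i"
        using dvd_diff[of "2 * int d" "e + 2 * int i" "e - 2 * int i"] by blast+
      then show ?thesis by (rule of_bool_disj_count)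
    qed
    show ?thesis
      unfolding incidence_def prod.case of_nat_add of_nat_of_bool distrib_left * G_def neg
      by (simp add: g_def)
  qed
  have "(if d dvd 2 * i then 2 else 1) * int (degree (Inr i)) = (\<Sum>(k, l)\<in>line_index. G k l)"
    unfolding degree_curve_sum of_nat_sum sum_distrib_left
  proof (rule sum.cong)
    fix v show "(if d dvd 2 * i then 2 else 1) * int (incidence v i) = (case v of (k, l) \<Rightarrow> G k l)"
      by (cases v) (simp only: prod.case count)
  qed simp
  also have "\<dots> = (\<Sum>(k, l)\<in>{1..<d * a} \<times> {1..<d * b}. G k l)"
  proof (rule sum.mono_neutral_left)
    show "line_index \<subseteq> {1..<d * a} \<times> {1..<d * b}" by (auto simp: line_index_def)
    have "G k l = 0" if "odd (k + l)" for k l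
    proof -
      have "\<not> 2 * int d dvd x" if "odd x" for x using that by (metis dvd_mult_left)
      then show ?thesis using that by (simp add: G_def neg) (simp add: g_def)
    qed
    then show "\<forall>x\<in>{1..<d * a} \<times> {1..<d * b} - line_index. (case x of (k, l) \<Rightarrow> G k l) = 0"
      by (auto simp: line_index_def)
  qed simp
  also have "\<dots> = (\<Sum>k\<in>{1..<d * a}. \<Sum>l\<in>{1..<d * b}. G k l)" by (simp add: sum.cartesian_product)
  also have "\<dots> = 2 * half_degree + (if int d dvd 2 * int i then 2 else 0)"
    using signed_incidence_count[of "2 * int i"] by (simp only: G_def g_def)
  also have "int d dvd 2 * int i \<longleftrightarrow> d dvd 2 * i"
    by (metis int_dvd_int_iff of_nat_mult of_nat_numeral)
  finally show ?thesis .
qed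

end

section \<open>Recovering the pair from the invariants\<close>

context torus_data
begin

lemma degree_curve_special: "d dvd 2 * i \<Longrightarrow> int (degree (Inr i)) = half_degree + 1"
  using degree_curve[of i] by simp

lemma degree_curve_generic: "\<not> d dvd 2 * i \<Longrightarrow> int (degree (Inr i)) = 2 * half_degree"
  using degree_curve[of i] by simp

text \<open>Each line has two incidences, so the number of lines is half the sum of the degrees of the
  curves. The real roots of unity are \<open>1\<close>, and \<open>- 1\<close> when \<open>d\<close> is even; their curves have
  the exceptional degree \<open>half_degree + 1\<close>.\<close>

lemma twice_card_line_index:
  assumes "d \<ge> 2"
  shows "2 * int (card line_index) = int d * half_degree + (if even d then 2 else 1)"
proof -
  have "4 * int (card line_index) = (\<Sum>v\<in>line_index. int (degree (Inl v))) + (\<Sum>i\<in>curve_index. int (degree (Inr i)))"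
    using arg_cong[OF sum_degree, of int] unfolding sum_component_index_split by simp
  also have "(\<Sum>v\<in>line_index. int (degree (Inl v))) = 2 * int (card line_index)"
    by (simp add: degree_line)
  finally have sum: "2 * int (card line_index) = (\<Sum>i\<in>curve_index. int (degree (Inr i)))" by simp
  have generic: "\<not> d dvd 2 * i" if "i \<noteq> 0" "2 * i < d" for i
    using that by (auto dest: dvd_imp_le)
  show ?thesis
  proof (cases "even d")
    case True
    then obtain j where d: "d = 2 * j" by (elim evenE)
    have "curve_index = insert 0 (insert j {1..<j})" using assms d unfolding curve_index_def by auto
    then have "(\<Sum>i\<in>curve_index. int (degree (Inr i)))
        = int (degree (Inr 0)) + int (degree (Inr j)) + (\<Sum>i\<in>{1..<j}. int (degree (Inr i)))"
      using assms by (simp add: d)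
    moreover have "(\<Sum>i\<in>{1..<j}. int (degree (Inr i))) = (\<Sum>i\<in>{1..<j}. 2 * half_degree)"
    proof (rule sum.cong)
      fix i assume "i \<in> {1..<j}"
      then have "i \<noteq> 0" "2 * i < d" using d by simp_all
      then show "int (degree (Inr i)) = 2 * half_degree" by (intro degree_curve_generic generic)
    qed simp
    moreover have "int (degree (Inr 0)) = half_degree + 1" by (rule degree_curve_special) simp
    moreover have "int (degree (Inr j)) = half_degree + 1" by (rule degree_curve_special) (use d in simp)
    moreover have "int (j - 1) = int j - 1" "int d = 2 * int j" using assms d by (simp_all add: of_nat_diff)
    ultimately show ?thesis unfolding sum using True by (simp add: algebra_simps)
  next
    case False
    then obtain j where d: "d = 2 * j + 1" by (elim oddE)
    have "curve_index = insert 0 {1..<j + 1}" using d unfolding curve_index_def by auto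
    then have "(\<Sum>i\<in>curve_index. int (degree (Inr i)))
        = int (degree (Inr 0)) + (\<Sum>i\<in>{1..<j + 1}. int (degree (Inr i)))"
      by simp
    moreover have "(\<Sum>i\<in>{1..<j + 1}. int (degree (Inr i))) = (\<Sum>i\<in>{1..<j + 1}. 2 * half_degree)"
    proof (rule sum.cong)
      fix i assume "i \<in> {1..<j + 1}"
      then have "i \<noteq> 0" "2 * i < d" using d by simp_all
      then show "int (degree (Inr i)) = 2 * half_degree" by (intro degree_curve_generic generic)
    qed simp
    moreover have "int (degree (Inr 0)) = half_degree + 1" by (rule degree_curve_special) simp
    moreover have "int d = 2 * int j + 1" using d by simp
    ultimately show ?thesis unfolding sum using False by (simp add: algebra_simps)
  qed
qed

lemma degree_values:
  "u \<in> component_index \<Longrightarrow> int (degree u) \<in> {2, half_degree + 1, 2 * half_degree}"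
  using degree_line degree_curve_special degree_curve_generic by (cases u) fastforce+

lemma degree_zero_curve: "half_degree + 1 \<in> (\<lambda>u. int (degree u)) ` component_index"
proof
  show "half_degree + 1 = int (degree (Inr 0))" using degree_curve_special[of 0] by simp
qed (simp add: curve_index_def)

end

text \<open>An isomorphism need not respect the distinction between lines and curves. It preserves
  the degrees; their sum is four times the number of lines, and the remaining components are the
  curves. It also preserves the number of ordered pairs meeting in exactly one point, which is
  four times the number of simple lines.\<close>

lemma combinatorial_invariants:
  assumes "torus_data d a b" "torus_data d' a' b'"
    and "same_combinatorial_structure (char_variety (d * a) (d * b)) (char_variety (d' * a') (d' * b'))"
  shows "d div 2 = d' div 2"
    and "card (torus_data.line_index d a b) = card (torus_data.line_index d' a' b')"
    and "card (torus_data.simple_lines d a b) = card (torus_data.simple_lines d' a' b')"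
    and "torus_data.degree d a b ` torus_data.component_index d a b
      = torus_data.degree d' a' b' ` torus_data.component_index d' a' b'"
proof -
  interpret X: torus_data d a b by fact
  interpret Y: torus_data d' a' b' by fact
  obtain \<gamma> where bij: "bij_betw \<gamma> X.component_index Y.component_index"
    and meet: "\<And>u v. u \<in> X.component_index \<Longrightarrow> v \<in> X.component_index \<Longrightarrow> u \<noteq> v \<Longrightarrow>
      X.meet u v = Y.meet (\<gamma> u) (\<gamma> v)"
    using assms(3) unfolding same_combinatorial_structure_iff[OF assms(1,2)] by blast
  have transfer: "(\<Sum>v\<in>X.component_index - {u}. f (X.meet u v))
      = (\<Sum>v\<in>Y.component_index - {\<gamma> u}. f (Y.meet (\<gamma> u) v))"
    if u: "u \<in> X.component_index" for u and f :: "nat \<Rightarrow> nat"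
  proof -
    have "bij_betw \<gamma> (X.component_index - {u}) (Y.component_index - {\<gamma> u})"
      using bij_betw_DiffI[OF bij, of "{u}" "{\<gamma> u}"] u bij by (auto simp: bij_betw_def)
    from sum.reindex_bij_betw[OF this, of "\<lambda>v. f (Y.meet (\<gamma> u) v)"]
    have "(\<Sum>v\<in>Y.component_index - {\<gamma> u}. f (Y.meet (\<gamma> u) v))
        = (\<Sum>v\<in>X.component_index - {u}. f (Y.meet (\<gamma> u) (\<gamma> v)))" by simp
    also have "\<dots> = (\<Sum>v\<in>X.component_index - {u}. f (X.meet u v))"
      by (rule sum.cong) (use u meet in auto)
    finally show ?thesis by simp
  qed
  have degree: "X.degree u = Y.degree (\<gamma> u)" if "u \<in> X.component_index" for u
    using transfer[OF that, of "\<lambda>x. x"] by (simp add: X.degree_def Y.degree_def)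
  show "X.degree ` X.component_index = Y.degree ` Y.component_index"
  proof -
    have "Y.degree ` Y.component_index = Y.degree ` \<gamma> ` X.component_index"
      using bij by (simp add: bij_betw_def)
    also have "\<dots> = X.degree ` X.component_index"
      unfolding image_image by (rule image_cong) (simp_all add: degree)
    finally show ?thesis by simp
  qed
  have "4 * card X.line_index = 4 * card Y.line_index"
    unfolding X.sum_degree[symmetric] Y.sum_degree[symmetric]
    using sum.reindex_bij_betw[OF bij, of Y.degree] by (simp add: degree)
  then show lines: "card X.line_index = card Y.line_index" by simp
  have "4 * card X.simple_lines
      = (\<Sum>u\<in>X.component_index. \<Sum>v\<in>Y.component_index - {\<gamma> u}. of_bool (Y.meet (\<gamma> u) v = 1))"
    unfolding X.sum_simple_meet[symmetric]
    by (rule sum.cong[OF HOL.refl]) (rule transfer[of _ "\<lambda>x. of_bool (x = 1)"])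
  also have "\<dots> = 4 * card Y.simple_lines"
    unfolding Y.sum_simple_meet[symmetric] by (rule sum.reindex_bij_betw[OF bij])
  finally have "4 * card X.simple_lines = 4 * card Y.simple_lines" .
  then show "card X.simple_lines = card Y.simple_lines" by simp
  show "d div 2 = d' div 2"
    using bij_betw_same_card[OF bij] lines by (simp add: X.card_component_index Y.card_component_index)
qed

lemma sum_prod_determine:
  fixes a b a' b' :: nat
  assumes "a + b = a' + b'" "a * b = a' * b'" "a \<ge> b" "a' \<ge> b'"
  shows "a = a' \<and> b = b'"
proof -
  have "(int a - int a') * (int a - int b') = int a * int a - int a * (int a' + int b') + int a' * int b'"
    by (simp add: algebra_simps)
  also have "int a' + int b' = int a + int b" using assms(1) by linarith
  also have "int a' * int b' = int a * int b" using assms(2) by (metis of_nat_mult)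
  finally have "(int a - int a') * (int a - int b') = 0" by (simp add: algebra_simps)
  then have "a = a' \<or> a = b'" by auto
  then show ?thesis using assms by auto
qed

text \<open>The simple lines give the product \<open>a b\<close>; then the number of lines gives the sum \<open>a + b\<close>.\<close>

lemma equal_gcd_determine:
  assumes "torus_data d a b" "torus_data d a' b'" "d \<ge> 2" "a \<ge> b" "a' \<ge> b'"
    and "card (torus_data.line_index d a b) = card (torus_data.line_index d a' b')"
    and "card (torus_data.simple_lines d a b) = card (torus_data.simple_lines d a' b')"
  shows "a = a' \<and> b = b'"
proof -
  interpret X: torus_data d a b by fact
  interpret Y: torus_data d a' b' by fact
  have "int d * X.half_degree = int d * Y.half_degree"
    using X.twice_card_line_index[OF assms(3)] Y.twice_card_line_index[OF assms(3)] assms(6) by linarith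
  then have half_degree: "X.half_degree = Y.half_degree" using assms(3) by simp
  have "d div 2 > 0" using assms(3) by simp
  then have prod: "a * b = a' * b'"
    using assms(7) unfolding X.card_simple_lines Y.card_simple_lines by simp
  then have "a + b = a' + b'"
    using half_degree by (simp add: X.half_degree_def Y.half_degree_def mult.assoc)
  then show ?thesis using sum_prod_determine prod assms(4,5) by blast
qed

text \<open>The number of curves leaves only the ambiguity between an even \<open>d\<close> and \<open>d + 1\<close>. With \<open>x\<close> and \<open>y\<close>
  the half degrees, equal numbers of lines give \<open>d x + 2 = (d + 1) y + 1\<close>. The curve with root of
  unity \<open>1\<close> has degree \<open>y + 1\<close> in the odd graph, so \<open>y + 1\<close> is one of the degrees \<open>2\<close>, \<open>x + 1\<close>, \<open>2 x\<close> of
  the even graph. Each possibility forces \<open>x = y = 1\<close>. For even \<open>d\<close> and \<open>a \<ge> b\<close> the equation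
  \<open>d a b - a - b = 1\<close> has only the solution \<open>d = 2\<close>, \<open>a = 2\<close>, \<open>b = 1\<close>; then \<open>3 a' b' - a' - b' = 1\<close>
  gives \<open>a' = b' = 1\<close>.\<close>

lemma even_odd_gcd_exception:
  assumes "torus_data d a b" "torus_data d' a' b'" "d \<ge> 2" "even d" "d' = Suc d" "a \<ge> b"
    and lines: "card (torus_data.line_index d a b) = card (torus_data.line_index d' a' b')"
    and degrees: "torus_data.degree d a b ` torus_data.component_index d a b
      = torus_data.degree d' a' b' ` torus_data.component_index d' a' b'"
  shows "d = 2 \<and> a = 2 \<and> b = 1 \<and> a' = 1 \<and> b' = 1"
proof -
  interpret X: torus_data d a b by fact
  interpret Y: torus_data d' a' b' by fact
  define x y where "x = X.half_degree" and "y = Y.half_degree"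
  have eq: "int d * x + 2 = (int d + 1) * y + 1"
    using X.twice_card_line_index[OF assms(3)] Y.twice_card_line_index lines assms(3-5)
    by (simp add: x_def y_def)
  have "y + 1 \<in> int ` Y.degree ` Y.component_index"
    using Y.degree_zero_curve by (simp add: y_def image_image)
  then have "y + 1 \<in> (\<lambda>u. int (X.degree u)) ` X.component_index"
    unfolding degrees[symmetric] by (simp add: image_image)
  then obtain u where "u \<in> X.component_index" "y + 1 = int (X.degree u)" by blast
  then have "y + 1 \<in> {2, x + 1, 2 * x}" using X.degree_values[of u] by (simp add: x_def)
  then consider "y = 1" | "y = x" | "y = 2 * x - 1" by fastforce
  then have xy: "x = 1 \<and> y = 1"
  proof cases
    case 1
    then have "int d * x = int d * 1" using eq by simp
    then show ?thesis using 1 assms(3) by simp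
  next
    case 2
    then show ?thesis using eq by (simp add: algebra_simps)
  next
    case 3
    have "(int d + 2) * (x - 1) = ((int d + 1) * (2 * x - 1) + 1) - (int d * x + 2)"
      by (simp add: algebra_simps)
    also have "\<dots> = 0" using eq 3 by simp
    finally have "(int d + 2) * (x - 1) = 0" .
    then show ?thesis using 3 by simp
  qed
  have X: "d * (a * b) = a + b + 1"
  proof -
    have "int (d * (a * b)) = int (a + b + 1)" using xy by (simp add: x_def X.half_degree_def algebra_simps)
    then show ?thesis by (simp only: of_nat_eq_iff)
  qed
  have Y: "(d + 1) * (a' * b') = a' + b' + 1"
  proof -
    have "int ((d + 1) * (a' * b')) = int (a' + b' + 1)"
    proof -
      have "int (d' * a' * b') - int a' - int b' = 1" using xy unfolding y_def Y.half_degree_def by simp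
      then show ?thesis unfolding assms(5) by (simp add: algebra_simps)
    qed
    then show ?thesis by (simp only: of_nat_eq_iff)
  qed
  have le: "a \<le> a * b" "b \<le> a * b" "a' \<le> a' * b'" "b' \<le> a' * b'"
    using X.pos Y.pos by simp_all
  have "d < 4"
  proof (rule ccontr)
    assume "\<not> d < 4"
    then have "4 * (a * b) \<le> d * (a * b)" by simp
    then show False using X le X.pos by linarith
  qed
  then have d: "d = 2" using assms(3,4) by (cases "d = 3") auto
  have "b = 1"
  proof (rule ccontr)
    assume "b \<noteq> 1"
    then have "2 \<le> b" using X.pos by simp
    then have "2 * a \<le> a * b" by (simp add: mult.commute)
    moreover have "2 * (a * b) = a + b + 1" using X unfolding d .
    ultimately show False using assms(6) \<open>2 \<le> b\<close> by linarith
  qed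
  moreover have "a = 2" using X d \<open>b = 1\<close> by simp
  moreover have "3 * (a' * b') = a' + b' + 1" using Y by (simp add: d)
  then have "a' * b' \<le> 1" using le by linarith
  then have "a' = 1 \<and> b' = 1" using le Y.pos by linarith
  ultimately show ?thesis using d by blast
qed

lemma torus_data_gcd:
  fixes m n :: nat
  assumes "m \<ge> 1" "n \<ge> 1"
  obtains a b where "torus_data (gcd m n) a b" "m = gcd m n * a" "n = gcd m n * b"
proof -
  have "gcd m n \<noteq> 0" using assms by simp
  then obtain a b where ab: "m = a * gcd m n" "n = b * gcd m n" "coprime a b"
    using gcd_coprime_exists[of m n] by blast
  have "gcd m n \<ge> 1" using \<open>gcd m n \<noteq> 0\<close> by linarith
  moreover have "a \<ge> 1" "b \<ge> 1" using ab(1,2) assms by (metis One_nat_def Suc_leI gr0I mult_0 not_one_le_zero)+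
  ultimately have "torus_data (gcd m n) a b"
    using ab(3) by (intro torus_data.intro)
  then show ?thesis using that[of a b] ab(1,2) by (simp add: mult.commute)
qed

text \<open>Both graphs are a cycle of length four: two lines, each meeting both of the two curves once.\<close>

lemma same_combinatorial_structure_33_42:
  "same_combinatorial_structure (char_variety 3 3) (char_variety 4 2)"
proof -
  interpret X: torus_data 3 1 1 by unfold_locales simp_all
  interpret Y: torus_data 2 2 1 by unfold_locales simp_all
  have "X.line_index = {(1, 1), (2, 2)}"
  proof (intro equalityI subsetI)
    fix v assume "v \<in> X.line_index"
    then obtain k l where v: "v = (k, l)" "0 < k" "k < 3" "0 < l" "l < 3" "even (k + l)"
      unfolding X.line_index_def by auto
    then have "k = 1 \<or> k = 2" "l = 1 \<or> l = 2" by linarith+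
    then show "v \<in> {(1, 1), (2, 2)}" using v by (elim disjE) simp_all
  next
    fix v :: "nat \<times> nat" assume "v \<in> {(1, 1), (2, 2)}"
    then have "v = (1, 1) \<or> v = (2, 2)" by simp
    then show "v \<in> X.line_index" unfolding X.line_index_def by (elim disjE) simp_all
  qed
  moreover have "X.curve_index = {0, 1}" unfolding X.curve_index_def by auto
  ultimately have IX: "X.component_index = {Inl (1, 1), Inl (2, 2), Inr 0, Inr 1}"
    unfolding X.component_index_def by (simp only: image_insert image_empty Un_insert_left Un_empty_left)
  have "Y.line_index = {(1, 1), (3, 1)}"
  proof (intro equalityI subsetI)
    fix v assume "v \<in> Y.line_index"
    then obtain k l where v: "v = (k, l)" "0 < k" "k < 4" "0 < l" "l < 2" "even (k + l)"
      unfolding Y.line_index_def by auto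
    have l: "l = 1" and "k = 1 \<or> k = 2 \<or> k = 3" using v(2-5) by linarith+
    then show "v \<in> {(1, 1), (3, 1)}" using v(1,6) unfolding l by (elim disjE) simp_all
  next
    fix v :: "nat \<times> nat" assume "v \<in> {(1, 1), (3, 1)}"
    then have "v = (1, 1) \<or> v = (3, 1)" by simp
    then show "v \<in> Y.line_index" unfolding Y.line_index_def by (elim disjE) simp_all
  qed
  moreover have "Y.curve_index = {0, 1}" unfolding Y.curve_index_def by auto
  ultimately have IY: "Y.component_index = {Inl (1, 1), Inl (3, 1), Inr 0, Inr 1}"
    unfolding Y.component_index_def by (simp only: image_insert image_empty Un_insert_left Un_empty_left)
  have iX: "X.incidence (1, 1) 0 = 1" "X.incidence (1, 1) 1 = 1" "X.incidence (2, 2) 0 = 1" "X.incidence (2, 2) 1 = 1"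
    unfolding X.incidence_def by simp_all
  have iY: "Y.incidence (1, 1) 0 = 1" "Y.incidence (1, 1) 1 = 1" "Y.incidence (3, 1) 0 = 1" "Y.incidence (3, 1) 1 = 1"
    unfolding Y.incidence_def by simp_all
  define \<gamma> :: "(nat \<times> nat) + nat \<Rightarrow> (nat \<times> nat) + nat"
    where "\<gamma> = id(Inl (2, 2) := Inl (3, 1))"
  have \<gamma>: "\<gamma> (Inl (1, 1)) = Inl (1, 1)" "\<gamma> (Inl (2, 2)) = Inl (3, 1)" "\<gamma> (Inr i) = Inr i" for i
    by (simp_all add: \<gamma>_def)
  have "bij_betw \<gamma> X.component_index Y.component_index"
    unfolding bij_betw_def IX IY by (simp add: \<gamma>[unfolded One_nat_def] inj_on_def)
  moreover have "\<forall>u\<in>X.component_index. \<forall>v\<in>X.component_index. u \<noteq> v \<longrightarrow> X.meet u v = Y.meet (\<gamma> u) (\<gamma> v)"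
    unfolding IX ball_simps by (simp only: \<gamma> X.meet.simps Y.meet.simps iX iY) simp
  ultimately have "same_combinatorial_structure (char_variety (3 * 1) (3 * 1)) (char_variety (2 * 2) (2 * 1))"
    using same_combinatorial_structure_iff[OF X.torus_data_axioms Y.torus_data_axioms] by blast
  then show ?thesis by simp
qed

theorem mainTheorem4:
  fixes m n :: nat
  assumes "m \<ge> n" and "n \<ge> 1" and "gcd m n \<noteq> 1"
  shows "(\<forall>m1 n1 :: nat. m1 \<ge> n1 \<and> n1 \<ge> 1 \<and>
            same_combinatorial_structure (char_variety m1 n1) (char_variety m n) \<longrightarrow>
            (m1, n1) = (m, n) \<or> {(m, n), (m1, n1)} = {(3, 3), (4, 2)}) \<and>
         same_combinatorial_structure (char_variety 3 3) (char_variety 4 2)"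
proof (intro conjI allI impI)
  fix m1 n1 :: nat
  assume "m1 \<ge> n1 \<and> n1 \<ge> 1 \<and> same_combinatorial_structure (char_variety m1 n1) (char_variety m n)"
  then have m1n1: "m1 \<ge> n1" "n1 \<ge> 1"
    and same: "same_combinatorial_structure (char_variety m1 n1) (char_variety m n)" by blast+
  define d d' where "d = gcd m n" and "d' = gcd m1 n1"
  obtain a b where ab: "torus_data d a b" "m = d * a" "n = d * b"
    using torus_data_gcd[of m n] assms(1,2) unfolding d_def by (metis le_trans)
  obtain a' b' where ab': "torus_data d' a' b'" "m1 = d' * a'" "n1 = d' * b'"
    using torus_data_gcd[of m1 n1] m1n1 unfolding d'_def by (metis le_trans)
  have pos: "d \<ge> 1" "d' \<ge> 1" using ab(1) ab'(1) by (simp_all add: torus_data_def)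
  have d2: "d \<ge> 2" using pos(1) assms(3) by (simp add: d_def)
  have order: "a \<ge> b" "a' \<ge> b'" using assms(1) m1n1(1) pos by (simp_all add: ab ab')
  have inv: "d' div 2 = d div 2"
    "card (torus_data.line_index d' a' b') = card (torus_data.line_index d a b)"
    "card (torus_data.simple_lines d' a' b') = card (torus_data.simple_lines d a b)"
    "torus_data.degree d' a' b' ` torus_data.component_index d' a' b'
      = torus_data.degree d a b ` torus_data.component_index d a b"
    using combinatorial_invariants[OF ab'(1) ab(1)] same by (simp_all add: ab ab')
  have "d' \<ge> 2" using inv(1) d2 by presburger
  have "d = d' \<or> even d \<and> d' = Suc d \<or> even d' \<and> d = Suc d'"
    using inv(1) by presburger
  then consider "d = d'" | "even d" "d' = Suc d" | "even d'" "d = Suc d'" by blast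
  then show "(m1, n1) = (m, n) \<or> {(m, n), (m1, n1)} = {(3, 3), (4, 2)}"
  proof cases
    case 1
    have "a' = a \<and> b' = b"
      using equal_gcd_determine[of d a' b' a b] ab(1) ab'(1) 1 d2 order inv(2,3) by simp
    then show ?thesis using ab ab' 1 by simp
  next
    case 2
    have "d = 2 \<and> a = 2 \<and> b = 1 \<and> a' = 1 \<and> b' = 1"
      by (rule even_odd_gcd_exception[OF ab(1) ab'(1) d2 2 order(1) inv(2,4)[symmetric]])
    then show ?thesis using ab ab' 2 by auto
  next
    case 3
    have "d' = 2 \<and> a' = 2 \<and> b' = 1 \<and> a = 1 \<and> b = 1"
      by (rule even_odd_gcd_exception[OF ab'(1) ab(1) \<open>d' \<ge> 2\<close> 3 order(2) inv(2,4)])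
    then show ?thesis using ab ab' 3 by auto
  qed
qed (rule same_combinatorial_structure_33_42)

end
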